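(* Let $p$ be a symmetric polynomial in two freely noncommuting variables $x,y$. If $p$ is $xy$-convex, then there exist a hermitian $xy$-pencil $\lambda\in\mathbb C\langle x,y\rangle$, a positive integer $k$ and an $xy$-pencil $\Lambda\in\mathbb C\langle x,y\rangle^{k\times 1}$ such that $$p=\lambda(x,y)+\Lambda(x,y)^*\Lambda(x,y).$$ The converse is also true: every polynomial $p$ of this form is $xy$-convex.
   Context: $\mathbb C\langle x,y\rangle$ is the algebra of polynomials in two freely noncommuting variables, with the involution that is conjugate linear, reverses products and fixes $x$ and $y$; $p$ is symmetric if $p^*=p$. Polynomials are evaluated at pairs $(X,Y)$ of hermitian complex matrices of the same (arbitrary) size. An $xy$-pencil (in these two variables) is an expression $A_0+A_1x+B_1y+C\,xy+D\,yx$ with $A_0,A_1,B_1,C,D$ complex matrices of the same size (scalars for $\lambda$, $k\times1$ matrices for $\Lambda$); it is hermitian if $A_0,A_1,B_1$ are hermitian and $D=C^*$. A polynomial $p$ is $xy$-convex (globally, i.e. on all pairs of hermitian matrices) if for all $n,m$, all pairs $(X,Y)$ of $n\times n$ hermitian matrices and all isometries $V:\mathbb C^m\to\mathbb C^n$ satisfying $V^*XYV=(V^*XV)(V^*YV)$ one has $p(V^*XV,V^*YV)\preceq V^*p(X,Y)V$. *)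

theory Defs
  imports
    "HOL-Library.Poly_Mapping"
    "Jordan_Normal_Form.Schur_Decomposition"
begin

section \<open>Polynomials in two freely noncommuting variables\<close>

datatype letter = LX | LY

text \<open>Words under concatenation, written additively because \<^theory>\<open>HOL-Library.Poly_Mapping\<close>
  builds the convolution product from an additive monoid of exponents. The monoid is not
  commutative, so the finitely supported functions on words form the free algebra.\<close>

datatype word = Word (letters: "letter list")

instantiation word :: monoid_add
begin

definition zero_word :: word where
  "0 = Word []"

definition plus_word :: "word \<Rightarrow> word \<Rightarrow> word" where
  "u + v = Word (letters u @ letters v)"

instance
  by standard (simp_all add: zero_word_def plus_word_def)

end

type_synonym ncpoly = "word \<Rightarrow>\<^sub>0 complex"

definition nc_const :: "complex \<Rightarrow> ncpoly" where
  "nc_const c = Poly_Mapping.single 0 c"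

definition nc_x :: ncpoly where
  "nc_x = Poly_Mapping.single (Word [LX]) 1"

definition nc_y :: ncpoly where
  "nc_y = Poly_Mapping.single (Word [LY]) 1"

definition nc_star :: "ncpoly \<Rightarrow> ncpoly" where
  "nc_star p = (\<Sum>w\<in>Poly_Mapping.keys p.
     Poly_Mapping.single (Word (rev (letters w))) (cnj (Poly_Mapping.lookup p w)))"

definition nc_symmetric :: "ncpoly \<Rightarrow> bool" where
  "nc_symmetric p \<longleftrightarrow> nc_star p = p"

text \<open>Adjoint of a matrix over the free algebra; \<^const>\<open>mat_adjoint\<close> is not available since it
  requires the entries to form a field.\<close>

definition nc_mat_adjoint :: "ncpoly mat \<Rightarrow> ncpoly mat" where
  "nc_mat_adjoint L = transpose_mat (map_mat nc_star L)"


section \<open>Evaluation at pairs of matrices\<close>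

definition word_eval :: "nat \<Rightarrow> complex mat \<Rightarrow> complex mat \<Rightarrow> word \<Rightarrow> complex mat" where
  "word_eval n X Y w =
     foldr (\<lambda>a M. (case a of LX \<Rightarrow> X | LY \<Rightarrow> Y) * M) (letters w) (1\<^sub>m n)"

text \<open>The linear combination of the matrices \<^term>\<open>word_eval n X Y w\<close> is written out entrywise
  because the type of matrices of all sizes has no zero, hence no big sum operator.\<close>

definition nc_eval :: "nat \<Rightarrow> ncpoly \<Rightarrow> complex mat \<Rightarrow> complex mat \<Rightarrow> complex mat" where
  "nc_eval n p X Y = mat n n (\<lambda>(i, j).
     \<Sum>w\<in>Poly_Mapping.keys p. Poly_Mapping.lookup p w * word_eval n X Y w $$ (i, j))"


section \<open>Hermitian matrices and the Loewner order\<close>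

definition hermitian_mat :: "nat \<Rightarrow> complex mat \<Rightarrow> bool" where
  "hermitian_mat n A \<longleftrightarrow> A \<in> carrier_mat n n \<and> mat_adjoint A = A"

text \<open>The order on \<^typ>\<open>complex\<close> is that of \<^theory>\<open>HOL-Library.Complex_Order\<close>: \<^prop>\<open>0 \<le> z\<close> states
  that \<^term>\<open>z :: complex\<close> is real and nonnegative.\<close>

definition psd_mat :: "nat \<Rightarrow> complex mat \<Rightarrow> bool" where
  "psd_mat n A \<longleftrightarrow> hermitian_mat n A \<and> (\<forall>v\<in>carrier_vec n. 0 \<le> (A *\<^sub>v v) \<bullet>c v)"

definition loewner_le :: "nat \<Rightarrow> complex mat \<Rightarrow> complex mat \<Rightarrow> bool" where
  "loewner_le n A B \<longleftrightarrow>
     A \<in> carrier_mat n n \<and> B \<in> carrier_mat n n \<and> psd_mat n (B - A)"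

text \<open>Isometries from complex \<open>m\<close>-space to complex \<open>n\<close>-space.\<close>

definition isometry_mat :: "nat \<Rightarrow> nat \<Rightarrow> complex mat \<Rightarrow> bool" where
  "isometry_mat n m V \<longleftrightarrow> V \<in> carrier_mat n m \<and> mat_adjoint V * V = 1\<^sub>m m"


section \<open>Convexity and pencils\<close>

definition xy_convex :: "ncpoly \<Rightarrow> bool" where
  "xy_convex p \<longleftrightarrow> (\<forall>n m X Y V.
     hermitian_mat n X \<longrightarrow> hermitian_mat n Y \<longrightarrow> isometry_mat n m V \<longrightarrow>
     mat_adjoint V * (X * Y) * V = (mat_adjoint V * X * V) * (mat_adjoint V * Y * V) \<longrightarrow>
     loewner_le m
       (nc_eval m p (mat_adjoint V * X * V) (mat_adjoint V * Y * V))
       (mat_adjoint V * nc_eval n p X Y * V))"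

definition xy_pencil_of ::
  "complex mat \<Rightarrow> complex mat \<Rightarrow> complex mat \<Rightarrow> complex mat \<Rightarrow> complex mat \<Rightarrow> ncpoly mat" where
  "xy_pencil_of A\<^sub>0 A\<^sub>1 B\<^sub>1 C D =
     map_mat nc_const A\<^sub>0
     + map_mat (\<lambda>c. nc_const c * nc_x) A\<^sub>1
     + map_mat (\<lambda>c. nc_const c * nc_y) B\<^sub>1
     + map_mat (\<lambda>c. nc_const c * (nc_x * nc_y)) C
     + map_mat (\<lambda>c. nc_const c * (nc_y * nc_x)) D"

definition xy_pencil :: "nat \<Rightarrow> nat \<Rightarrow> ncpoly mat \<Rightarrow> bool" where
  "xy_pencil k l L \<longleftrightarrow> (\<exists>A\<^sub>0 A\<^sub>1 B\<^sub>1 C D.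
     A\<^sub>0 \<in> carrier_mat k l \<and> A\<^sub>1 \<in> carrier_mat k l \<and> B\<^sub>1 \<in> carrier_mat k l \<and>
     C \<in> carrier_mat k l \<and> D \<in> carrier_mat k l \<and>
     L = xy_pencil_of A\<^sub>0 A\<^sub>1 B\<^sub>1 C D)"

definition hermitian_xy_pencil :: "nat \<Rightarrow> ncpoly mat \<Rightarrow> bool" where
  "hermitian_xy_pencil d L \<longleftrightarrow> (\<exists>A\<^sub>0 A\<^sub>1 B\<^sub>1 C D.
     hermitian_mat d A\<^sub>0 \<and> hermitian_mat d A\<^sub>1 \<and> hermitian_mat d B\<^sub>1 \<and>
     C \<in> carrier_mat d d \<and> D = mat_adjoint C \<and>
     L = xy_pencil_of A\<^sub>0 A\<^sub>1 B\<^sub>1 C D)"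

end

(*
  Write A' for the adjoint of A. An xy-pencil L satisfies L(V'XV, V'YV) = V' L(X,Y) V for the
  admissible isometries V, so the convexity defect of L'L is V'L'(1 - VV')LV, which is positive
  semidefinite.

  Conversely, let p be convex and look at tuples whose off-diagonal blocks (between the range of V
  and its complement) are small. To leading order the defect only sees the ways in which a word
  leaves the range of V and comes back. The resulting hermitian form is positive semidefinite, so
  a nonzero off-diagonal entry forces nonzero diagonal entries. With a path graph as upper left block
  this shows that p has degree at most 4, contains no cube of a variable, and no word of length 4
  that begins or ends with a square. Hence every word of p has the form u'v with u, v among
  1, x, y, xy, yx, and it remains to find a positive semidefinite Gram matrix in (x, y, xy, yx),
  some of whose entries p leaves free. By the separation theorem, if there is none, then some
  positive definite matrix H, with zeros and real entries exactly where the Gram matrix is free,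
  pairs negatively with p. A factorization of H yields hermitian matrices that contradict
  convexity already for compressions to a one-dimensional space on which X and Y vanish.
*)
theory Submission
  imports "HOL-Analysis.Starlike" Defs
begin

section \<open>Adjoints and positive semidefinite matrices\<close>

lemma mat_adjoint_eq: "mat_adjoint A = mat (dim_col A) (dim_row A) (\<lambda>(i, j). cnj (A $$ (j, i)))"
  by (rule eq_matI) (auto simp: mat_adjoint_def mat_of_rows_def)

lemma dim_mat_adjoint [simp]:
  fixes A :: "complex mat"
  shows "dim_row (mat_adjoint A) = dim_col A" "dim_col (mat_adjoint A) = dim_row A"
  by (simp_all add: mat_adjoint_eq)

lemma mat_adjoint_closed [simp]:
  fixes A :: "complex mat"
  shows "A \<in> carrier_mat n m \<Longrightarrow> mat_adjoint A \<in> carrier_mat m n"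
  by auto

lemma index_mat_adjoint [simp]:
  "i < dim_col A \<Longrightarrow> j < dim_row A \<Longrightarrow> mat_adjoint A $$ (i, j) = cnj (A $$ (j, i))"
  by (simp add: mat_adjoint_eq)

lemma index_mult_mat_sum:
  fixes A B :: "'a::comm_semiring_0 mat"
  assumes "A \<in> carrier_mat n k" "B \<in> carrier_mat k m" "i < n" "j < m"
  shows "(A * B) $$ (i, j) = (\<Sum>l<k. A $$ (i, l) * B $$ (l, j))"
  using assms by (auto simp: scalar_prod_def atLeast0LessThan)

lemma mat_adjoint_mult:
  fixes A B :: "complex mat"
  assumes A: "A \<in> carrier_mat n k" and B: "B \<in> carrier_mat k m"
  shows "mat_adjoint (A * B) = mat_adjoint B * mat_adjoint A"
proof (rule eq_matI)
  fix i j assume "i < dim_row (mat_adjoint B * mat_adjoint A)"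
    and "j < dim_col (mat_adjoint B * mat_adjoint A)"
  then have ij: "i < m" "j < n" using A B by auto
  have "mat_adjoint (A * B) $$ (i, j) = cnj (\<Sum>l<k. A $$ (j, l) * B $$ (l, i))"
    using A B ij index_mult_mat_sum[OF A B ij(2,1)] by simp
  also have "\<dots> = (\<Sum>l<k. mat_adjoint B $$ (i, l) * mat_adjoint A $$ (l, j))"
    using A B ij by (simp add: mult.commute)
  also have "\<dots> = (mat_adjoint B * mat_adjoint A) $$ (i, j)"
    using index_mult_mat_sum[OF mat_adjoint_closed[OF B] mat_adjoint_closed[OF A] ij] by simp
  finally show "mat_adjoint (A * B) $$ (i, j) = (mat_adjoint B * mat_adjoint A) $$ (i, j)" .
qed (use A B in auto)

lemma mat_adjoint_adjoint [simp]: "mat_adjoint (mat_adjoint A) = (A :: complex mat)"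
  by (rule eq_matI) auto

text \<open>Premises about dimensions instead of carriers leave no intermediate size to guess, so
  the simplifier can reassociate products on its own.\<close>

lemma mat_mult_assoc_dim:
  fixes A B C :: "'a::semiring_0 mat"
  shows "dim_col A = dim_row B \<Longrightarrow> dim_col B = dim_row C \<Longrightarrow> A * B * C = A * (B * C)"
  by (rule assoc_mult_mat) auto

lemma mat_adjoint_mult_dim:
  fixes A B :: "complex mat"
  shows "dim_col A = dim_row B \<Longrightarrow> mat_adjoint (A * B) = mat_adjoint B * mat_adjoint A"
  by (rule mat_adjoint_mult[of A "dim_row A" "dim_col A" B "dim_col B"]) auto

lemma mat_adjoint_add:
  fixes A B :: "complex mat"
  assumes "A \<in> carrier_mat n m" "B \<in> carrier_mat n m"
  shows "mat_adjoint (A + B) = mat_adjoint A + mat_adjoint B"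
  by (rule eq_matI) (use assms in auto)

lemma mat_adjoint_minus:
  fixes A B :: "complex mat"
  assumes "A \<in> carrier_mat n m" "B \<in> carrier_mat n m"
  shows "mat_adjoint (A - B) = mat_adjoint A - mat_adjoint B"
  by (rule eq_matI) (use assms in auto)

lemma mat_adjoint_smult:
  "mat_adjoint (c \<cdot>\<^sub>m A) = cnj c \<cdot>\<^sub>m mat_adjoint A"
  by (rule eq_matI) auto

lemma mat_adjoint_one [simp]: "mat_adjoint (1\<^sub>m n) = (1\<^sub>m n :: complex mat)"
  by (rule eq_matI) auto

lemma mat_adjoint_zero [simp]: "mat_adjoint (0\<^sub>m n m) = (0\<^sub>m m n :: complex mat)"
  by (rule eq_matI) auto

lemma scalar_prod_adjoint:
  fixes A :: "complex mat"
  assumes A: "A \<in> carrier_mat n m" and v: "v \<in> carrier_vec m" and w: "w \<in> carrier_vec n"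
  shows "(mat_adjoint A *\<^sub>v w) \<bullet>c v = w \<bullet>c (A *\<^sub>v v)"
proof -
  have "(mat_adjoint A *\<^sub>v w) \<bullet>c v = (\<Sum>i<m. (\<Sum>j<n. cnj (A $$ (j, i)) * w $ j) * cnj (v $ i))"
    using assms by (auto simp: scalar_prod_def atLeast0LessThan)
  also have "\<dots> = (\<Sum>i<m. \<Sum>j<n. w $ j * cnj (A $$ (j, i) * v $ i))"
    by (simp add: sum_distrib_left sum_distrib_right mult_ac)
  also have "\<dots> = (\<Sum>j<n. \<Sum>i<m. w $ j * cnj (A $$ (j, i) * v $ i))"
    by (rule sum.swap)
  also have "\<dots> = w \<bullet>c (A *\<^sub>v v)"
    using assms by (auto simp: scalar_prod_def atLeast0LessThan sum_distrib_left)
  finally show ?thesis .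
qed

lemma psd_mat_gram:
  assumes A: "A \<in> carrier_mat n m"
  shows "psd_mat m (mat_adjoint A * A)"
  unfolding psd_mat_def
proof (intro conjI ballI)
  show "hermitian_mat m (mat_adjoint A * A)"
    using A mat_adjoint_mult[of "mat_adjoint A" m n A m] by (auto simp: hermitian_mat_def)
  fix v :: "complex vec" assume v: "v \<in> carrier_vec m"
  have "((mat_adjoint A * A) *\<^sub>v v) \<bullet>c v = (A *\<^sub>v v) \<bullet>c (A *\<^sub>v v)"
    using A v scalar_prod_adjoint[OF A v, of "A *\<^sub>v v"]
    by (simp add: assoc_mult_mat_vec[of _ m n _ m])
  then show "0 \<le> ((mat_adjoint A * A) *\<^sub>v v) \<bullet>c v"
    by (metis conjugate_square_ge_0_vec)
qed

lemma psd_mat_add: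
  assumes "psd_mat n A" "psd_mat n B"
  shows "psd_mat n (A + B)"
proof -
  have AB: "A \<in> carrier_mat n n" "B \<in> carrier_mat n n"
    using assms by (auto simp: psd_mat_def hermitian_mat_def)
  have "((A + B) *\<^sub>v v) \<bullet>c v = (A *\<^sub>v v) \<bullet>c v + (B *\<^sub>v v) \<bullet>c v" if "v \<in> carrier_vec n" for v
    using AB that by (simp add: add_mult_distrib_mat_vec[of _ n n] add_scalar_prod_distrib[of _ n])
  then show ?thesis
    using assms AB mat_adjoint_add[OF AB] by (auto simp: psd_mat_def hermitian_mat_def)
qed

lemma psd_mat_zero: "psd_mat n (0\<^sub>m n n)"
  using psd_mat_gram[of "0\<^sub>m n n" n n] by simp


section \<open>Evaluation as a star homomorphism\<close>

lemma word_eval_Nil [simp]: "word_eval n X Y (Word []) = 1\<^sub>m n"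
  by (simp add: word_eval_def)

lemma word_eval_Cons [simp]:
  "word_eval n X Y (Word (a # w)) = (case a of LX \<Rightarrow> X | LY \<Rightarrow> Y) * word_eval n X Y (Word w)"
  by (simp add: word_eval_def)

lemma word_eval_closed [simp]:
  assumes "X \<in> carrier_mat n n" "Y \<in> carrier_mat n n"
  shows "word_eval n X Y w \<in> carrier_mat n n"
proof -
  have "word_eval n X Y (Word u) \<in> carrier_mat n n" for u
    by (induction u) (use assms in \<open>auto split: letter.splits\<close>)
  then show ?thesis by (cases w) auto
qed

lemma word_eval_plus:
  assumes XY: "X \<in> carrier_mat n n" "Y \<in> carrier_mat n n"
  shows "word_eval n X Y (u + v) = word_eval n X Y u * word_eval n X Y v"
proof -
  have "word_eval n X Y (Word (a @ b)) = word_eval n X Y (Word a) * word_eval n X Y (Word b)" for a b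
  proof (induction a)
    case (Cons l a)
    then show ?case
      using XY assoc_mult_mat[of _ n n "word_eval n X Y (Word a)" n "word_eval n X Y (Word b)" n]
      by (cases l) simp_all
  qed (use word_eval_closed[OF XY, of "Word b"] in simp)
  then show ?thesis by (cases u; cases v) (simp add: plus_word_def)
qed

lemma word_eval_rev:
  assumes X: "hermitian_mat n X" and Y: "hermitian_mat n Y"
  shows "word_eval n X Y (Word (rev w)) = mat_adjoint (word_eval n X Y (Word w))"
proof (induction w)
  case (Cons a w)
  have XY: "X \<in> carrier_mat n n" "Y \<in> carrier_mat n n" "mat_adjoint X = X" "mat_adjoint Y = Y"
    using X Y by (auto simp: hermitian_mat_def)
  have "word_eval n X Y (Word (rev (a # w))) = word_eval n X Y (Word (rev w)) * word_eval n X Y (Word [a])"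
    using word_eval_plus[OF XY(1,2), of "Word (rev w)" "Word [a]"] by (simp add: plus_word_def)
  then show ?case
    using XY Cons mat_adjoint_mult[of _ n n "word_eval n X Y (Word w)" n]
    by (cases a) simp_all
qed simp

text \<open>Updating a fresh key amounts to adding a monomial, so additive statements about
  polynomials need only be checked on monomials.\<close>

lemma poly_mapping_add_induct [case_names zero add]:
  fixes p :: "'a \<Rightarrow>\<^sub>0 'b::monoid_add"
  assumes "P 0" and add: "\<And>w c q. P q \<Longrightarrow> P (Poly_Mapping.single w c + q)"
  shows "P p"
proof (induction p rule: update_induct)
  case (update q w c)
  have "Poly_Mapping.update w c q = Poly_Mapping.single w c + q"
    using update(1) by (intro poly_mapping_eqI) (auto simp: lookup_update lookup_add lookup_single in_keys_iff when_def)
  then show ?case using add update by simp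
qed (fact assms)

lemma nc_eval_closed [simp]: "nc_eval n p X Y \<in> carrier_mat n n"
  by (simp add: nc_eval_def)

lemma nc_eval_dim [simp]: "dim_row (nc_eval n p X Y) = n" "dim_col (nc_eval n p X Y) = n"
  by (simp_all add: nc_eval_def)

lemma nc_eval_index:
  assumes "i < n" "j < n" "finite S" "Poly_Mapping.keys p \<subseteq> S"
  shows "nc_eval n p X Y $$ (i, j) = (\<Sum>w\<in>S. Poly_Mapping.lookup p w * word_eval n X Y w $$ (i, j))"
  using assms by (auto simp: nc_eval_def in_keys_iff intro!: sum.mono_neutral_left)

lemma nc_eval_zero [simp]: "nc_eval n 0 X Y = 0\<^sub>m n n"
  by (rule eq_matI) (auto simp: nc_eval_def)

lemma nc_eval_add: "nc_eval n (p + q) X Y = nc_eval n p X Y + nc_eval n q X Y"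
proof (rule eq_matI)
  fix i j assume "i < dim_row (nc_eval n p X Y + nc_eval n q X Y)" "j < dim_col (nc_eval n p X Y + nc_eval n q X Y)"
  then have ij: "i < n" "j < n" by auto
  let ?S = "Poly_Mapping.keys p \<union> Poly_Mapping.keys q"
  show "nc_eval n (p + q) X Y $$ (i, j) = (nc_eval n p X Y + nc_eval n q X Y) $$ (i, j)"
    using ij keys_add[of p q]
    by (simp add: nc_eval_index[where S = ?S] lookup_add distrib_right sum.distrib)
qed auto

lemma nc_eval_single:
  assumes "X \<in> carrier_mat n n" "Y \<in> carrier_mat n n"
  shows "nc_eval n (Poly_Mapping.single w c) X Y = c \<cdot>\<^sub>m word_eval n X Y w"
proof (rule eq_matI)
  fix i j assume "i < dim_row (c \<cdot>\<^sub>m word_eval n X Y w)" "j < dim_col (c \<cdot>\<^sub>m word_eval n X Y w)"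
  then have "i < n" "j < n" using word_eval_closed[OF assms, of w] by auto
  then show "nc_eval n (Poly_Mapping.single w c) X Y $$ (i, j) = (c \<cdot>\<^sub>m word_eval n X Y w) $$ (i, j)"
    using word_eval_closed[OF assms, of w] by (simp add: nc_eval_index[where S = "{w}"])
qed (use word_eval_closed[OF assms, of w] in auto)

text \<open>Both sides are bilinear in \<open>p\<close> and \<open>q\<close>; two nested inductions
  reduce the claim to monomials, where it is \<open>word_eval_plus\<close>.\<close>

lemma nc_eval_mult:
  assumes XY: "X \<in> carrier_mat n n" "Y \<in> carrier_mat n n"
  shows "nc_eval n (p * q) X Y = nc_eval n p X Y * nc_eval n q X Y"
proof (induction p rule: poly_mapping_add_induct)
  case (add u c p)
  have "nc_eval n (Poly_Mapping.single u c * q) X Y = nc_eval n (Poly_Mapping.single u c) X Y * nc_eval n q X Y"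
  proof (induction q rule: poly_mapping_add_induct)
    case zero
    show ?case by (simp add: right_mult_zero_mat[of _ n n])
  next
    case (add v d q)
    let ?U = "word_eval n X Y u" and ?V = "word_eval n X Y v"
    have "(c \<cdot>\<^sub>m ?U) * (d \<cdot>\<^sub>m ?V) = c \<cdot>\<^sub>m (d \<cdot>\<^sub>m (?U * ?V))"
      using word_eval_closed[OF XY, of u] word_eval_closed[OF XY, of v]
      by (metis mult_smult_distrib mult_smult_assoc_mat smult_carrier_mat)
    then have "(c \<cdot>\<^sub>m ?U) * (d \<cdot>\<^sub>m ?V) = (c * d) \<cdot>\<^sub>m (?U * ?V)"
      by (auto intro: eq_matI)
    then have "nc_eval n (Poly_Mapping.single u c * Poly_Mapping.single v d) X Y
        = nc_eval n (Poly_Mapping.single u c) X Y * nc_eval n (Poly_Mapping.single v d) X Y"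
      by (simp add: mult_single nc_eval_single[OF XY] word_eval_plus[OF XY])
    then show ?case
      by (simp add: distrib_left nc_eval_add add mult_add_distrib_mat[of _ n n _ n])
  qed
  then show ?case
    by (simp add: distrib_right nc_eval_add add add_mult_distrib_mat[of _ n n _ _ n])
qed (simp add: left_mult_zero_mat[of _ n n])

section \<open>The involution and its compatibility with evaluation\<close>

lemma lookup_nc_star: "Poly_Mapping.lookup (nc_star p) w = cnj (Poly_Mapping.lookup p (Word (rev (letters w))))"
proof -
  let ?r = "\<lambda>w. Word (rev (letters w))"
  have r: "?r u = w \<longleftrightarrow> u = ?r w" for u by (cases u; cases w) auto
  have "Poly_Mapping.lookup (nc_star p) w
      = (\<Sum>u\<in>Poly_Mapping.keys p. if u = ?r w then cnj (Poly_Mapping.lookup p u) else 0)"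
    by (simp add: nc_star_def lookup_sum lookup_single when_def r)
  then show ?thesis by (auto simp: in_keys_iff)
qed

lemma nc_star_zero [simp]: "nc_star 0 = 0"
  by (rule poly_mapping_eqI) (simp add: lookup_nc_star)

lemma nc_star_add: "nc_star (p + q) = nc_star p + nc_star q"
  by (rule poly_mapping_eqI) (simp add: lookup_nc_star lookup_add)

lemma nc_star_single:
  "nc_star (Poly_Mapping.single (Word w) c) = Poly_Mapping.single (Word (rev w)) (cnj c)"
proof (rule poly_mapping_eqI)
  fix u show "Poly_Mapping.lookup (nc_star (Poly_Mapping.single (Word w) c)) u
      = Poly_Mapping.lookup (Poly_Mapping.single (Word (rev w)) (cnj c)) u"
    by (cases u) (auto simp: lookup_nc_star lookup_single when_def)
qed

lemma nc_eval_star: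
  assumes X: "hermitian_mat n X" and Y: "hermitian_mat n Y"
  shows "nc_eval n (nc_star p) X Y = mat_adjoint (nc_eval n p X Y)"
proof (induction p rule: poly_mapping_add_induct)
  case (add w c p)
  have XY: "X \<in> carrier_mat n n" "Y \<in> carrier_mat n n"
    using X Y by (auto simp: hermitian_mat_def)
  obtain u where w: "w = Word u" by (cases w)
  show ?case
    using XY by (simp add: w nc_star_add nc_eval_add nc_star_single nc_eval_single word_eval_rev[OF X Y]
        mat_adjoint_add[of _ n n] mat_adjoint_smult add)
qed simp

section \<open>Pencil plus sum of squares is convex\<close>

text \<open>Additive in \<open>p\<close>, and positive semidefinite for all admissible data exactly
  when \<open>p\<close> is convex.\<close>

definition convexity_defect ::
  "nat \<Rightarrow> nat \<Rightarrow> complex mat \<Rightarrow> complex mat \<Rightarrow> complex mat \<Rightarrow> ncpoly \<Rightarrow> complex mat" where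
  "convexity_defect n m X Y V p = mat_adjoint V * nc_eval n p X Y * V
     - nc_eval m p (mat_adjoint V * X * V) (mat_adjoint V * Y * V)"

locale xy_compression =
  fixes n m :: nat and X Y V :: "complex mat"
  assumes hermX: "hermitian_mat n X" and hermY: "hermitian_mat n Y"
    and iso: "isometry_mat n m V"
    and compress_xy: "mat_adjoint V * (X * Y) * V = (mat_adjoint V * X * V) * (mat_adjoint V * Y * V)"
begin

abbreviation "X' \<equiv> mat_adjoint V * X * V"
abbreviation "Y' \<equiv> mat_adjoint V * Y * V"

lemma closed [simp]:
  "X \<in> carrier_mat n n" "Y \<in> carrier_mat n n" "V \<in> carrier_mat n m"
  using hermX hermY iso by (auto simp: hermitian_mat_def isometry_mat_def)

lemma dims [simp]:
  "dim_row X = n" "dim_col X = n" "dim_row Y = n" "dim_col Y = n" "dim_row V = n" "dim_col V = m"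
  using carrier_matD[OF closed(1)] carrier_matD[OF closed(2)] carrier_matD[OF closed(3)] by auto

lemma adj [simp]: "mat_adjoint X = X" "mat_adjoint Y = Y"
  using hermX hermY by (auto simp: hermitian_mat_def)

lemma herm': "hermitian_mat m X'" "hermitian_mat m Y'"
  by (auto simp: hermitian_mat_def mat_adjoint_mult_dim mat_mult_assoc_dim)

lemma closed': "X' \<in> carrier_mat m m" "Y' \<in> carrier_mat m m"
  using herm' by (simp_all add: hermitian_mat_def)

text \<open>Since \<open>X\<close> and \<open>Y\<close> are hermitian, this is the adjoint of the
  assumption on \<open>X * Y\<close>.\<close>

lemma compress_yx: "mat_adjoint V * (Y * X) * V = Y' * X'"
proof -
  have "mat_adjoint V * (Y * X) * V = mat_adjoint (mat_adjoint V * (X * Y) * V)"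
    by (simp add: mat_adjoint_mult_dim mat_mult_assoc_dim)
  also have "\<dots> = mat_adjoint (X' * Y')"
    by (simp only: compress_xy)
  also have "\<dots> = Y' * X'"
    by (simp add: mat_adjoint_mult_dim mat_mult_assoc_dim)
  finally show ?thesis .
qed

lemma compress_add:
  assumes "A \<in> carrier_mat n n" "B \<in> carrier_mat n n"
  shows "mat_adjoint V * (A + B) * V = mat_adjoint V * A * V + mat_adjoint V * B * V"
proof -
  have V: "mat_adjoint V \<in> carrier_mat m n" by simp
  then show ?thesis
    using mult_add_distrib_mat[OF V assms]
      add_mult_distrib_mat[of "mat_adjoint V * A" m n "mat_adjoint V * B" V m] assms
    by (simp add: mult_carrier_mat[OF V])
qed

lemma compress_smult:
  assumes "A \<in> carrier_mat n n"
  shows "mat_adjoint V * (c \<cdot>\<^sub>m A) * V = c \<cdot>\<^sub>m (mat_adjoint V * A * V)"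
proof -
  have V: "mat_adjoint V \<in> carrier_mat m n" by simp
  then show ?thesis
    using mult_smult_distrib[OF V assms, of c]
      mult_smult_assoc_mat[of "mat_adjoint V * A" m n V m c] assms
    by (simp add: mult_carrier_mat[OF V])
qed

abbreviation "D \<equiv> convexity_defect n m X Y V"

lemma defect_add: "D (p + q) = D p + D q"
  by (rule eq_matI) (simp_all add: convexity_defect_def nc_eval_add compress_add del: index_mult_mat(1))

lemma defect_zero: "D 0 = 0\<^sub>m m m"
  by (rule eq_matI) (auto simp: convexity_defect_def nc_eval_zero right_mult_zero_mat[of _ m n] left_mult_zero_mat[of _ n m])

text \<open>For these words compression commutes with evaluation: the empty word because
  \<open>V\<close> is an isometry, the mixed products by \<open>compress_xy\<close> and
  \<open>compress_yx\<close>.\<close>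

lemma defect_single:
  assumes "w \<in> {[], [LX], [LY], [LX, LY], [LY, LX]}"
  shows "D (Poly_Mapping.single (Word w) c) = 0\<^sub>m m m"
proof -
  have V1: "mat_adjoint V * V = 1\<^sub>m m" using iso by (simp add: isometry_mat_def)
  have "mat_adjoint V * word_eval n X Y (Word w) * V = word_eval m X' Y' (Word w)"
    using assms V1 compress_xy compress_yx by auto
  then show ?thesis
    using word_eval_closed[OF closed', of "Word w"]
    by (simp add: convexity_defect_def nc_eval_single[OF closed'] nc_eval_single[OF closed(1,2)]
        compress_smult minus_r_inv_mat[of _ m m])
qed

text \<open>If \<open>D L = 0\<close>, the defect of \<open>L\<^sup>* L\<close> is the square of \<open>(1 - V V\<^sup>*) L(X, Y) V\<close>.\<close>

lemma psd_defect_star_mult: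
  assumes "D L = 0\<^sub>m m m"
  shows "psd_mat m (D (nc_star L * L))"
proof -
  define A where "A = nc_eval n L X Y"
  \<comment> \<open>Projection onto the orthogonal complement of the range of \<open>V\<close>;
    being self-adjoint and idempotent, it can be shared between the two factors at the end.\<close>
  define P where "P = 1\<^sub>m n - V * mat_adjoint V"
  have dA [simp]: "dim_row A = n" "dim_col A = n" by (simp_all add: A_def)
  have dP [simp]: "dim_row P = n" "dim_col P = n" by (simp_all add: P_def)
  have V1: "mat_adjoint V * V = 1\<^sub>m m" using iso by (simp add: isometry_mat_def)
  have adjP: "mat_adjoint P = P"
    using mat_adjoint_minus[of "1\<^sub>m n" n n "V * mat_adjoint V"]
    by (simp add: P_def mat_adjoint_mult_dim carrier_matI)
  have VP: "mat_adjoint V * P = 0\<^sub>m m n"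
  proof -
    have "mat_adjoint V * P = mat_adjoint V * 1\<^sub>m n - mat_adjoint V * (V * mat_adjoint V)"
      unfolding P_def by (rule mult_minus_distrib_mat[of _ m n _ n]) auto
    also have "mat_adjoint V * (V * mat_adjoint V) = mat_adjoint V"
      using mat_mult_assoc_dim[of "mat_adjoint V" V "mat_adjoint V"] V1
        left_mult_one_mat[of "mat_adjoint V" m n] by simp
    finally show ?thesis using right_mult_one_mat[of "mat_adjoint V" m n] by auto
  qed
  have PP: "P * P = P"
  proof -
    have "P * P = 1\<^sub>m n * P - V * mat_adjoint V * P"
      by (subst (1) P_def, rule minus_mult_distrib_mat[of _ n n _ _ n]) auto
    also have "\<dots> = P"
      using left_mult_one_mat[of P n n] right_mult_zero_mat[of V n m n]
      by (auto simp: mat_mult_assoc_dim VP intro!: eq_matI)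
    finally show ?thesis .
  qed
  \<comment> \<open>The vanishing defect of \<open>L\<close> enters here: evaluating
    \<open>L\<close> commutes with compression.\<close>
  have eq: "nc_eval m L X' Y' = mat_adjoint V * A * V"
  proof (rule eq_matI)
    fix i j assume "i < dim_row (mat_adjoint V * A * V)" "j < dim_col (mat_adjoint V * A * V)"
    then have "i < m" "j < m" by auto
    moreover from this have "D L $$ (i, j) = 0" using assms by simp
    ultimately show "nc_eval m L X' Y' $$ (i, j) = (mat_adjoint V * A * V) $$ (i, j)"
      by (simp add: convexity_defect_def A_def)
  qed auto
  define B where "B = A * V"
  have dB [simp]: "dim_row B = n" "dim_col B = m" by (simp_all add: B_def)
  have eval_n: "mat_adjoint V * nc_eval n (nc_star L * L) X Y * V = mat_adjoint B * B"
    by (simp add: nc_eval_mult nc_eval_star[OF hermX hermY] A_def[symmetric] B_def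
        mat_adjoint_mult_dim mat_mult_assoc_dim)
  have eval_m: "nc_eval m (nc_star L * L) X' Y' = mat_adjoint B * (V * mat_adjoint V * B)"
    unfolding nc_eval_mult[OF closed'] nc_eval_star[OF herm'] eq
    by (simp add: B_def mat_adjoint_mult_dim mat_mult_assoc_dim)
  have "mat_adjoint B * B - mat_adjoint B * (V * mat_adjoint V * B) = mat_adjoint B * (B - V * mat_adjoint V * B)"
    by (rule mult_minus_distrib_mat[of _ m n _ m, symmetric]) auto
  also have "B - V * mat_adjoint V * B = P * B"
    using minus_mult_distrib_mat[of "1\<^sub>m n" n n "V * mat_adjoint V" B m] left_mult_one_mat[of B n m]
    by (simp add: P_def carrier_matI)
  also have "\<dots> = P * (P * B)"
    by (simp add: mat_mult_assoc_dim[symmetric] PP)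
  also have "mat_adjoint B * (P * (P * B)) = mat_adjoint (P * B) * (P * B)"
    by (simp add: mat_adjoint_mult_dim adjP mat_mult_assoc_dim)
  finally have "D (nc_star L * L) = mat_adjoint (P * B) * (P * B)"
    by (simp add: convexity_defect_def eval_n eval_m)
  then show ?thesis
    using psd_mat_gram[of "P * B" n m] by (simp add: carrier_matI)
qed

end

lemma xy_convex_iff_psd_defect:
  "xy_convex p \<longleftrightarrow> (\<forall>n m X Y V. xy_compression n m X Y V \<longrightarrow> psd_mat m (convexity_defect n m X Y V p))"
proof -
  have "loewner_le m (nc_eval m p (mat_adjoint V * X * V) (mat_adjoint V * Y * V))
      (mat_adjoint V * nc_eval n p X Y * V) \<longleftrightarrow> psd_mat m (convexity_defect n m X Y V p)"
    if "xy_compression n m X Y V" for n m X Y V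
  proof -
    interpret xy_compression n m X Y V by (fact that)
    show ?thesis by (simp add: loewner_le_def convexity_defect_def carrier_matI)
  qed
  then show ?thesis by (auto simp: xy_convex_def xy_compression_def)
qed

section \<open>Entries of pencils as polynomials\<close>

lemma nc_const_eq: "nc_const c = Poly_Mapping.single (Word []) c"
  by (simp add: nc_const_def zero_word_def)

lemma const_mult_word:
  "nc_const c * nc_x = Poly_Mapping.single (Word [LX]) c"
  "nc_const c * nc_y = Poly_Mapping.single (Word [LY]) c"
  "nc_const c * (nc_x * nc_y) = Poly_Mapping.single (Word [LX, LY]) c"
  "nc_const c * (nc_y * nc_x) = Poly_Mapping.single (Word [LY, LX]) c"
  by (simp_all add: nc_const_eq nc_x_def nc_y_def mult_single plus_word_def)

definition pencil_poly :: "complex \<Rightarrow> complex \<Rightarrow> complex \<Rightarrow> complex \<Rightarrow> complex \<Rightarrow> ncpoly" where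
  "pencil_poly a0 a1 b1 c d = Poly_Mapping.single (Word []) a0 + Poly_Mapping.single (Word [LX]) a1
     + Poly_Mapping.single (Word [LY]) b1 + Poly_Mapping.single (Word [LX, LY]) c
     + Poly_Mapping.single (Word [LY, LX]) d"

lemma index_xy_pencil_of:
  assumes "A\<^sub>0 \<in> carrier_mat k l" "A\<^sub>1 \<in> carrier_mat k l" "B\<^sub>1 \<in> carrier_mat k l"
    "C \<in> carrier_mat k l" "D \<in> carrier_mat k l" "i < k" "j < l"
  shows "xy_pencil_of A\<^sub>0 A\<^sub>1 B\<^sub>1 C D $$ (i, j)
    = pencil_poly (A\<^sub>0 $$ (i, j)) (A\<^sub>1 $$ (i, j)) (B\<^sub>1 $$ (i, j)) (C $$ (i, j)) (D $$ (i, j))"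
  using assms by (simp add: xy_pencil_of_def pencil_poly_def const_mult_word) (simp add: nc_const_eq)

lemma index_nc_gram:
  assumes "L \<in> carrier_mat k 1"
  shows "(nc_mat_adjoint L * L) $$ (0, 0) = (\<Sum>i<k. nc_star (L $$ (i, 0)) * L $$ (i, 0))"
  using assms by (auto simp: nc_mat_adjoint_def scalar_prod_def atLeast0LessThan intro!: sum.cong)

text \<open>Pencils have zero defect, so \<open>l\<close> contributes nothing and every entry of
  \<open>\<Lambda>\<close> satisfies the premise of \<open>psd_defect_star_mult\<close>; the defects
  of the squares add up.\<close>

lemma xy_convex_pencil_plus_squares:
  assumes l: "hermitian_xy_pencil 1 (mat 1 1 (\<lambda>_. l))" and L: "xy_pencil k 1 \<Lambda>"
    and p: "p = l + (nc_mat_adjoint \<Lambda> * \<Lambda>) $$ (0, 0)"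
  shows "xy_convex p"
  unfolding xy_convex_iff_psd_defect
proof (intro allI impI)
  fix n m X Y V assume "xy_compression n m X Y V"
  then interpret xy_compression n m X Y V .
  have D0: "D (pencil_poly a0 a1 b1 c d) = 0\<^sub>m m m" for a0 a1 b1 c d
    by (simp add: pencil_poly_def defect_add defect_single)
  obtain A0 A1 B1 C D' where 1: "A0 \<in> carrier_mat 1 1" "A1 \<in> carrier_mat 1 1" "B1 \<in> carrier_mat 1 1"
    "C \<in> carrier_mat 1 1" "D' \<in> carrier_mat 1 1" "mat 1 1 (\<lambda>_. l) = xy_pencil_of A0 A1 B1 C D'"
    using l unfolding hermitian_xy_pencil_def hermitian_mat_def by (metis mat_adjoint_closed)
  have "l = mat 1 1 (\<lambda>_. l) $$ (0, 0)" by simp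
  also have "\<dots> = pencil_poly (A0 $$ (0, 0)) (A1 $$ (0, 0)) (B1 $$ (0, 0)) (C $$ (0, 0)) (D' $$ (0, 0))"
    using 1 by (simp only: index_xy_pencil_of[OF 1(1-5)])
  finally have l0: "D l = 0\<^sub>m m m" by (metis D0)
  obtain A0 A1 B1 C D' where 2: "A0 \<in> carrier_mat k 1" "A1 \<in> carrier_mat k 1" "B1 \<in> carrier_mat k 1"
    "C \<in> carrier_mat k 1" "D' \<in> carrier_mat k 1" "\<Lambda> = xy_pencil_of A0 A1 B1 C D'"
    using L unfolding xy_pencil_def by blast
  have \<Lambda>: "\<Lambda> \<in> carrier_mat k 1"
    using 2 by (auto simp: xy_pencil_of_def)
  have "psd_mat m (D (\<Sum>i<j. nc_star (\<Lambda> $$ (i, 0)) * \<Lambda> $$ (i, 0)))" if "j \<le> k" for j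
    using that
  proof (induction j)
    case 0
    show ?case by (simp add: defect_zero psd_mat_zero)
  next
    case (Suc j)
    have "D (\<Lambda> $$ (j, 0)) = 0\<^sub>m m m"
      using 2 Suc(2) by (simp add: index_xy_pencil_of[OF 2(1-5)] D0)
    then show ?case using Suc by (simp add: defect_add psd_mat_add psd_defect_star_mult)
  qed
  from this[of k] show "psd_mat m (D p)"
    by (simp add: p index_nc_gram[OF \<Lambda>] defect_add l0 psd_mat_add psd_mat_zero)
qed

section \<open>Leaving and re-entering the compressed space\<close>

text \<open>The vector obtained by applying a word to the first basis vector. The size is a
  parameter, so that the same entry function \<open>B\<close> describes both the full matrices and
  their upper left blocks.\<close>

primrec word_col :: "nat \<Rightarrow> (letter \<Rightarrow> nat \<Rightarrow> nat \<Rightarrow> complex) \<Rightarrow> letter list \<Rightarrow> nat \<Rightarrow> complex" where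
  "word_col n B [] i = (if i = 0 then 1 else 0)"
| "word_col n B (a # w) i = (\<Sum>j<n. B a i j * word_col n B w j)"

lemma word_eval_word_col:
  assumes "0 < n" "i < n"
  shows "word_eval n (mat n n (\<lambda>(i, j). B LX i j)) (mat n n (\<lambda>(i, j). B LY i j)) (Word w) $$ (i, 0)
    = word_col n B w i"
  using assms(2)
proof (induction w arbitrary: i)
  case (Cons a w)
  let ?X = "mat n n (\<lambda>(i, j). B LX i j)" and ?Y = "mat n n (\<lambda>(i, j). B LY i j)"
  have "word_eval n ?X ?Y (Word w) \<in> carrier_mat n n" by simp
  then show ?case
    using Cons assms(1) index_mult_mat_sum[of "case a of LX \<Rightarrow> ?X | LY \<Rightarrow> ?Y" n n "word_eval n ?X ?Y (Word w)" n i 0]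
    by (cases a) (simp_all del: index_mult_mat)
qed (use assms(1) in simp)

lemma psd_mat_diag:
  assumes "psd_mat n A" "i < n"
  shows "0 \<le> A $$ (i, i)"
proof -
  have A: "A \<in> carrier_mat n n" using assms by (simp add: psd_mat_def hermitian_mat_def)
  have "(A *\<^sub>v unit_vec n i) \<bullet>c unit_vec n i = A $$ (i, i)"
    using A assms(2) by (simp add: scalar_prod_def unit_vec_def if_distrib[of cnj] if_distrib[of "\<lambda>x. _ * x"]
        cong: if_cong)
  then show ?thesis using assms by (metis psd_mat_def unit_vec_carrier)
qed

text \<open>Take for \<open>V\<close> the inclusion of the first \<open>m\<close> basis vectors.
  Compression then means passing to the upper left block, \<open>orth\<close> is the admissibility
  condition, and the claim is the entry \<open>(0, 0)\<close> of the defect.\<close>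

lemma xy_convex_word_col:
  assumes p: "xy_convex p" and m: "0 < m" "m \<le> n"
    and herm: "\<And>a i j. i < n \<Longrightarrow> j < n \<Longrightarrow> B a j i = cnj (B a i j)"
    and orth: "\<And>i j. i < m \<Longrightarrow> j < m \<Longrightarrow> (\<Sum>k=m..<n. B LX i k * B LY k j) = 0"
  shows "0 \<le> (\<Sum>w\<in>Poly_Mapping.keys p.
    Poly_Mapping.lookup p w * (word_col n B (letters w) 0 - word_col m B (letters w) 0))"
proof -
  define M where "M k a = mat k k (\<lambda>(i, j). B a i j)" for k a
  define V :: "complex mat" where "V = mat n m (\<lambda>(i, j). if i = j then 1 else 0)"
  have V: "V \<in> carrier_mat n m" by (simp add: V_def)
  have M: "M k a \<in> carrier_mat k k" for k a by (simp add: M_def)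
  have compress: "mat_adjoint V * A * V = mat m m (\<lambda>(i, j). A $$ (i, j))" if A: "A \<in> carrier_mat n n" for A
  proof (rule eq_matI)
    fix i j assume "i < dim_row (mat m m (\<lambda>(i, j). A $$ (i, j)))" "j < dim_col (mat m m (\<lambda>(i, j). A $$ (i, j)))"
    then have ij: "i < m" "j < m" "i < n" "j < n" using m by auto
    have AV: "A * V \<in> carrier_mat n m" using A V by simp
    have "(mat_adjoint V * (A * V)) $$ (i, j) = (\<Sum>k<n. cnj (V $$ (k, i)) * (\<Sum>l<n. A $$ (k, l) * V $$ (l, j)))"
      using ij V A by (simp add: index_mult_mat_sum[OF mat_adjoint_closed[OF V] AV]
          index_mult_mat_sum[OF A V] del: index_mult_mat)
    also have "\<dots> = (\<Sum>k<n. (if k = i then 1 else 0) * (\<Sum>l<n. A $$ (k, l) * (if l = j then 1 else 0)))"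
      using ij by (intro sum.cong refl arg_cong2[of _ _ _ _ "(*)"]) (auto simp: V_def)
    also have "\<dots> = A $$ (i, j)"
      using ij by (simp add: if_distrib[of "\<lambda>x. x * _"] if_distrib[of "\<lambda>x. _ * x"] cong: if_cong)
    finally show "(mat_adjoint V * A * V) $$ (i, j) = mat m m (\<lambda>(i, j). A $$ (i, j)) $$ (i, j)"
      using ij A V by (simp add: mat_mult_assoc_dim[of "mat_adjoint V" A V] del: index_mult_mat)
  qed (use V in auto)
  have compress_M: "mat_adjoint V * M n a * V = M m a" for a
    unfolding compress[OF M] using m by (auto simp: M_def)
  have M_herm: "hermitian_mat n (M n a)" for a
    unfolding hermitian_mat_def
  proof
    show "mat_adjoint (M n a) = M n a"
    proof (rule eq_matI)
      fix i j assume "i < dim_row (M n a)" "j < dim_col (M n a)"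
      then show "mat_adjoint (M n a) $$ (i, j) = M n a $$ (i, j)"
        using herm[of j i a] by (simp add: M_def)
    qed (simp_all add: M_def)
  qed (rule M)
  have iso: "isometry_mat n m V"
    using compress[of "1\<^sub>m n"] m V by (auto simp: isometry_mat_def intro!: eq_matI)
  have xy: "mat_adjoint V * (M n LX * M n LY) * V = M m LX * M m LY"
  proof -
    have "mat_adjoint V * (M n LX * M n LY) * V = mat m m (\<lambda>(i, j). (M n LX * M n LY) $$ (i, j))"
      by (rule compress) (rule mult_carrier_mat[OF M M])
    also have "\<dots> = M m LX * M m LY"
    proof (rule eq_matI)
      fix i j assume "i < dim_row (M m LX * M m LY)" "j < dim_col (M m LX * M m LY)"
      then have ij: "i < m" "j < m" "i < n" "j < n" using m by (auto simp: M_def)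
      have "(M n LX * M n LY) $$ (i, j) = (\<Sum>k<n. B LX i k * B LY k j)"
        using ij unfolding index_mult_mat_sum[OF M M ij(3,4)] by (simp add: M_def)
      also have "\<dots> = (\<Sum>k<m. B LX i k * B LY k j) + (\<Sum>k=m..<n. B LX i k * B LY k j)"
        using m by (metis atLeast0LessThan le0 sum.atLeastLessThan_concat)
      also have "\<dots> = (M m LX * M m LY) $$ (i, j)"
        using ij orth[of i j] unfolding index_mult_mat_sum[OF M M ij(1,2)] by (simp add: M_def)
      finally show "mat m m (\<lambda>(i, j). (M n LX * M n LY) $$ (i, j)) $$ (i, j) = (M m LX * M m LY) $$ (i, j)"
        using ij by simp
    qed (auto simp: M_def)
    finally show ?thesis .
  qed
  have "loewner_le m (nc_eval m p (M m LX) (M m LY)) (mat_adjoint V * nc_eval n p (M n LX) (M n LY) * V)"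
    using p M_herm iso xy unfolding xy_convex_def compress_M[symmetric] by blast
  then have "0 \<le> (mat_adjoint V * nc_eval n p (M n LX) (M n LY) * V - nc_eval m p (M m LX) (M m LY)) $$ (0, 0)"
    using m psd_mat_diag unfolding loewner_le_def by blast
  also have "\<dots> = nc_eval n p (M n LX) (M n LY) $$ (0, 0) - nc_eval m p (M m LX) (M m LY) $$ (0, 0)"
    using m compress[of "nc_eval n p (M n LX) (M n LY)"] V by (simp del: index_mult_mat(1))
  also have "nc_eval n p (M n LX) (M n LY) $$ (0, 0)
      = (\<Sum>w\<in>Poly_Mapping.keys p. Poly_Mapping.lookup p w * word_col n B (letters w) 0)"
    using m by (simp add: nc_eval_index[where S = "Poly_Mapping.keys p"] M_def word_eval_word_col[symmetric])
  also have "nc_eval m p (M m LX) (M m LY) $$ (0, 0)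
      = (\<Sum>w\<in>Poly_Mapping.keys p. Poly_Mapping.lookup p w * word_col m B (letters w) 0)"
    using m by (simp add: nc_eval_index[where S = "Poly_Mapping.keys p"] M_def word_eval_word_col[symmetric])
  finally show ?thesis by (simp add: sum_subtractf right_diff_distrib)
qed

text \<open>The summands correspond to the factorizations of a word as \<open>rev u' @ a # w'\<close>: the letter \<open>a\<close>
  is the last one to re-enter the span of the first \<open>m\<close> basis vectors.\<close>

primrec reentry ::
  "nat \<Rightarrow> nat \<Rightarrow> (letter \<Rightarrow> nat \<Rightarrow> nat \<Rightarrow> complex) \<Rightarrow> letter list \<Rightarrow> letter list \<Rightarrow> complex" where
  "reentry m n B u [] = 0"
| "reentry m n B u (a # w) =
    (\<Sum>k=m..<n. cnj (\<Sum>i<m. B a k i * word_col m B u i) * word_col n B w k) + reentry m n B (a # u) w"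

text \<open>Split the sum behind the first letter \<open>a\<close>: from an outer index,
  \<open>a\<close> makes the last re-entry; from an inner one, the difference passes on to
  \<open>w\<close>, and hermitian symmetry moves \<open>a\<close> over to \<open>u\<close>.\<close>

lemma word_col_diff_reentry:
  assumes m: "m \<le> n" and herm: "\<And>a i j. i < n \<Longrightarrow> j < n \<Longrightarrow> B a j i = cnj (B a i j)"
  shows "(\<Sum>i<m. cnj (word_col m B u i) * (word_col n B w i - word_col m B w i)) = reentry m n B u w"
proof (induction w arbitrary: u)
  case (Cons a w)
  let ?c = "\<lambda>i. cnj (word_col m B u i)"
  have herm': "cnj (B a k i) = B a i k" if "i < m" "k < n" for i k
    using herm[of i k a] that m by simp
  have split: "word_col n B (a # w) i - word_col m B (a # w) i
      = (\<Sum>k=m..<n. B a i k * word_col n B w k) + (\<Sum>k<m. B a i k * (word_col n B w k - word_col m B w k))" for i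
  proof -
    have "word_col n B (a # w) i = (\<Sum>k<m. B a i k * word_col n B w k) + (\<Sum>k=m..<n. B a i k * word_col n B w k)"
      using m by (simp add: lessThan_atLeast0 sum.atLeastLessThan_concat)
    then show ?thesis by (simp add: right_diff_distrib sum_subtractf)
  qed
  have swap: "(\<Sum>i<m. ?c i * (\<Sum>k\<in>K. B a i k * f k)) = (\<Sum>k\<in>K. cnj (\<Sum>i<m. B a k i * word_col m B u i) * f k)"
    if "K \<subseteq> {..<n}" for K f
  proof -
    have "(\<Sum>i<m. ?c i * (\<Sum>k\<in>K. B a i k * f k)) = (\<Sum>k\<in>K. \<Sum>i<m. ?c i * (B a i k * f k))"
      by (simp add: sum_distrib_left sum.swap[of _ K])
    also have "\<dots> = (\<Sum>k\<in>K. cnj (\<Sum>i<m. B a k i * word_col m B u i) * f k)"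
      using that by (auto simp: sum_distrib_left herm' subset_eq mult_ac intro!: sum.cong)
    finally show ?thesis .
  qed
  have "(\<Sum>i<m. ?c i * (word_col n B (a # w) i - word_col m B (a # w) i))
      = (\<Sum>i<m. ?c i * (\<Sum>k=m..<n. B a i k * word_col n B w k))
        + (\<Sum>i<m. ?c i * (\<Sum>k<m. B a i k * (word_col n B w k - word_col m B w k)))"
    by (simp only: split distrib_left sum.distrib)
  also have "(\<Sum>i<m. ?c i * (\<Sum>k=m..<n. B a i k * word_col n B w k))
      = (\<Sum>k=m..<n. cnj (\<Sum>i<m. B a k i * word_col m B u i) * word_col n B w k)"
    by (rule swap) auto
  also have "(\<Sum>i<m. ?c i * (\<Sum>k<m. B a i k * (word_col n B w k - word_col m B w k))) = reentry m n B (a # u) w"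
    using swap[of "{..<m}" "\<lambda>k. word_col n B w k - word_col m B w k"] Cons[of "a # u"] m by simp
  finally show ?case by simp
qed simp

text \<open>Lets positivity survive the limit in \<open>xy_convex_reentry\<close>.\<close>

lemma closed_complex_nonneg: "closed {z::complex. 0 \<le> z}"
proof -
  have "{z::complex. 0 \<le> z} = {z. 0 \<le> Re z} \<inter> {z. Im z = 0}"
    by (auto simp: less_eq_complex_def)
  then show ?thesis
    by (auto intro!: closed_Int closed_Collect_le closed_Collect_eq continuous_intros)
qed

text \<open>The entry \<open>(i, j)\<close> is scaled by \<open>s ^ \<bar>d i - d j\<bar>\<close> with \<open>d i = min i m\<close>. Conjugation
  by \<open>diag (s ^ d i)\<close> turns this factor into \<open>s ^ (2 * (d j - d i))\<close> (truncated subtraction), which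
  at \<open>s = 0\<close> leaves only the entries with \<open>d j \<le> d i\<close>.\<close>

lemma xy_convex_reentry:
  assumes p: "xy_convex p" and m: "0 < m" "m \<le> n"
    and herm: "\<And>a i j. i < n \<Longrightarrow> j < n \<Longrightarrow> B a j i = cnj (B a i j)"
    and orth: "\<And>i j. i < m \<Longrightarrow> j < m \<Longrightarrow> (\<Sum>k=m..<n. B LX i k * B LY k j) = 0"
  shows "0 \<le> (\<Sum>w\<in>Poly_Mapping.keys p. Poly_Mapping.lookup p w *
    reentry m n (\<lambda>a i j. if min j m \<le> min i m then B a i j else 0) [] (letters w))"
proof -
  define d where "d i = min i m" for i
  define S where "S s a i j = of_real s ^ ((d i - d j) + (d j - d i)) * B a i j" for s :: real and a i j
  define H where "H s a i j = of_real s ^ (2 * (d j - d i)) * B a i j" for s :: real and a i j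
  have d0: "d 0 = 0" by (simp add: d_def)
  have col: "word_col k (S s) w i = of_real s ^ d i * word_col k (H s) w i" for k s w i
  proof (induction w arbitrary: i)
    case (Cons a w)
    have "S s a i j * (of_real s ^ d j * c) = of_real s ^ d i * (H s a i j * c)" for j c
    proof -
      have "(d i - d j) + (d j - d i) + d j = d i + 2 * (d j - d i)" by simp
      then have "(of_real s :: complex) ^ ((d i - d j) + (d j - d i)) * of_real s ^ d j
          = of_real s ^ d i * of_real s ^ (2 * (d j - d i))"
        by (simp only: power_add[symmetric])
      then show ?thesis by (simp add: S_def H_def mult_ac)
    qed
    then show ?case unfolding word_col.simps Cons sum_distrib_left by (intro sum.cong refl)
  qed (auto simp: d0)
  \<comment> \<open>Both factors of a summand are taken at an outer index, where \<open>d\<close>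
    equals \<open>m\<close>, so each contributes \<open>s ^ m\<close>.\<close>
  have reentry_S: "reentry m n (S s) u w = of_real (s ^ (2 * m)) * reentry m n (H s) u w" for s u w
  proof (induction w arbitrary: u)
    case (Cons a w)
    have *: "S s a k i * (of_real s ^ d i * c) = of_real s ^ m * (H s a k i * c)" if "m \<le> k" "i < m" for k i c
    proof -
      have "d k = m" "d i = i" using that by (auto simp: d_def)
      then have "(d k - d i) + (d i - d k) + d i = m + 2 * (d i - d k)" using that by simp
      then have "(of_real s :: complex) ^ ((d k - d i) + (d i - d k)) * of_real s ^ d i
          = of_real s ^ m * of_real s ^ (2 * (d i - d k))"
        by (simp only: power_add[symmetric])
      then show ?thesis by (simp add: S_def H_def mult_ac)
    qed
    have up: "(\<Sum>i<m. S s a k i * word_col m (S s) u i) = of_real s ^ m * (\<Sum>i<m. H s a k i * word_col m (H s) u i)"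
      if "m \<le> k" for k
      unfolding col sum_distrib_left by (intro sum.cong refl *) (use that in auto)
    have down: "word_col n (S s) w k = of_real s ^ m * word_col n (H s) w k" if "m \<le> k" for k
      using that by (simp add: col d_def)
    have "cnj (\<Sum>i<m. S s a k i * word_col m (S s) u i) * word_col n (S s) w k
        = of_real (s ^ (2 * m)) * (cnj (\<Sum>i<m. H s a k i * word_col m (H s) u i) * word_col n (H s) w k)"
      if "m \<le> k" for k
      unfolding up[OF that] down[OF that] by (simp add: mult_2 power_add del: cnj_sum)
    then have "(\<Sum>k=m..<n. cnj (\<Sum>i<m. S s a k i * word_col m (S s) u i) * word_col n (S s) w k)
        = of_real (s ^ (2 * m)) * (\<Sum>k=m..<n. cnj (\<Sum>i<m. H s a k i * word_col m (H s) u i) * word_col n (H s) w k)"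
      unfolding sum_distrib_left[of "of_real (s ^ (2 * m))"] by (intro sum.cong refl) auto
    then show ?case by (simp only: reentry.simps Cons distrib_left)
  qed simp
  define q where "q s = (\<Sum>w\<in>Poly_Mapping.keys p. Poly_Mapping.lookup p w * reentry m n (H s) [] (letters w))" for s
  have pos: "0 \<le> q s" if s: "0 < s" for s
  proof -
    have hermS: "S s a j i = cnj (S s a i j)" if "i < n" "j < n" for a i j
      using herm[OF that, of a] by (simp add: S_def add.commute)
    have "(\<Sum>k=m..<n. S s LX i k * S s LY k j) = 0" if ij: "i < m" "j < m" for i j
    proof -
      \<comment> \<open>All outer indices have level \<open>m\<close>, so the scaling factor does
        not depend on \<open>k\<close> and orthogonality is preserved.\<close>
      have "S s LX i k * S s LY k j = of_real s ^ (m - i) * of_real s ^ (m - j) * (B LX i k * B LY k j)" if "m \<le> k" for k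
        using ij that by (simp add: S_def d_def)
      then have "(\<Sum>k=m..<n. S s LX i k * S s LY k j)
          = of_real s ^ (m - i) * of_real s ^ (m - j) * (\<Sum>k=m..<n. B LX i k * B LY k j)"
        by (simp add: sum_distrib_left)
      then show ?thesis using orth[OF ij] by simp
    qed
    note nonneg = xy_convex_word_col[OF p m, of "S s", OF hermS this]
    have "word_col n (S s) w 0 - word_col m (S s) w 0 = of_real (s ^ (2 * m)) * reentry m n (H s) [] w" for w
    proof -
      have "(\<Sum>i<m. cnj (word_col m (S s) [] i) * (word_col n (S s) w i - word_col m (S s) w i))
          = word_col n (S s) w 0 - word_col m (S s) w 0"
        using m by (simp add: if_distrib[of cnj] if_distrib[of "\<lambda>x. x * _"] cong: if_cong)
      then show ?thesis
        using word_col_diff_reentry[OF m(2), of "S s" "[]" w, OF hermS] by (simp add: reentry_S)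
    qed
    then have "0 \<le> of_real (s ^ (2 * m)) * q s"
      using nonneg by (simp add: q_def sum_distrib_left mult_ac)
    moreover have "0 < s ^ (2 * m)" using s by simp
    ultimately show ?thesis
      using s by (auto simp: less_eq_complex_def zero_le_mult_iff simp del: of_real_power)
  qed
  have contH: "continuous_on UNIV (\<lambda>s. H s a i j)" for a i j
    unfolding H_def by (intro continuous_intros)
  have cont_col: "continuous_on UNIV (\<lambda>s. word_col k (H s) w i)" for k w i
    by (induction w arbitrary: i) (auto intro!: continuous_intros contH)
  have "continuous_on UNIV (\<lambda>s. reentry m n (H s) u w)" for u w
    by (induction w arbitrary: u) (auto intro!: continuous_intros contH cont_col)
  then have cont: "continuous_on UNIV q"
    unfolding q_def by (intro continuous_intros)
  \<comment> \<open>Positivity is known for \<open>s > 0\<close> and passes to \<open>s = 0\<close>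
    by continuity.\<close>
  have "(\<lambda>k. q (1 / of_nat (Suc k))) \<longlonglongrightarrow> q 0"
    using cont LIMSEQ_Suc[OF lim_1_over_n[where 'a=real]]
    by (intro continuous_on_tendsto_compose[OF cont]) (auto intro!: always_eventually)
  then have "q 0 \<in> {z. 0 \<le> z}"
    by (rule closed_sequentially[OF closed_complex_nonneg, rotated]) (auto intro!: pos)
  moreover have "H 0 = (\<lambda>a i j. if min j m \<le> min i m then B a i j else 0)"
    by (intro ext) (auto simp: H_def d_def power_0_left)
  ultimately show ?thesis by (simp add: q_def)
qed

section \<open>Bounding the degree\<close>

text \<open>There is no constant term, and for small \<open>z\<close> the linear part dominates, so
  it must vanish in every direction. That the values are real forces \<open>Q\<close> to be the
  conjugate of \<open>P\<close>.\<close>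

lemma hermitian_quadratic_zero:
  fixes A P Q :: complex
  assumes "\<And>z. 0 \<le> cnj z * z * A + cnj z * P + z * Q"
  shows "P = 0"
proof -
  have A: "0 \<le> Re A + Re P + Re Q" "0 \<le> Re A - Re P - Re Q" "Im A + Im P + Im Q = 0" "Im A - Im P - Im Q = 0"
    using assms[of 1] assms[of "- 1"] by (auto simp: less_eq_complex_def)
  have lin: "0 \<le> Re (cnj u * P + u * Q)" for u
  proof (rule ccontr)
    assume "\<not> 0 \<le> Re (cnj u * P + u * Q)"
    then have neg: "Re (cnj u * P + u * Q) < 0" by simp
    define a where "a = Re (cnj u * u * A)"
    define b where "b = - Re (cnj u * P + u * Q)"
    \<comment> \<open>So small that the quadratic term offsets at most half of the linear
      one.\<close>
    define t where "t = b / (2 * (\<bar>a\<bar> + 1))"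
    have t: "0 < t" using neg by (simp add: t_def b_def)
    have "0 \<le> cnj (of_real t * u) * (of_real t * u) * A + cnj (of_real t * u) * P + (of_real t * u) * Q"
      by (rule assms)
    also have "\<dots> = of_real t * (of_real t * (cnj u * u * A) + (cnj u * P + u * Q))"
      by (simp add: algebra_simps)
    finally have "0 \<le> Re (of_real t * (of_real t * (cnj u * u * A) + (cnj u * P + u * Q)))"
      by (simp only: less_eq_complex_def zero_complex.simps)
    also have "\<dots> = t * (t * a - b)"
      by (simp only: a_def b_def times_complex.simps plus_complex.simps Re_complex_of_real Im_complex_of_real mult_zero_left diff_zero minus_minus diff_minus_eq_add)
    finally have "0 \<le> t * (t * a - b)" .
    then have "b \<le> t * a" using t by (simp add: zero_le_mult_iff)
    also have "\<dots> \<le> t * (\<bar>a\<bar> + 1)" using t by (intro mult_left_mono) auto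
    also have "\<dots> = b / 2" by (simp add: t_def field_simps)
    finally have "b \<le> 0" by simp
    then show False using neg by (simp only: b_def neg_le_0_iff_le)
  qed
  have "Re (P + Q) = 0" using lin[of 1] lin[of "- 1"] by simp
  moreover have "Im P - Im Q = 0" using lin[of \<i>] lin[of "- \<i>"] by simp
  moreover have imA: "Im A = 0" "Im P + Im Q = 0" using A by auto
  \<comment> \<open>Reality of the value at \<open>z = \<i>\<close> makes the real parts of
    \<open>P\<close> and \<open>Q\<close> equal.\<close>
  moreover have "Im (cnj \<i> * \<i> * A + cnj \<i> * P + \<i> * Q) = 0"
    using assms[of \<i>] by (simp only: less_eq_complex_def zero_complex.simps)
  ultimately show ?thesis by (simp add: complex_eq_iff)
qed

text \<open>Outer coordinates of the vector of a word when nothing returns from the \<open>r\<close>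
  outer basis vectors: \<open>c\<close> is the outer block, and \<open>\<eta> a w\<close> is what
  the letter \<open>a\<close> sends outside from the inner part of the vector of
  \<open>w\<close>.\<close>

primrec lower_part ::
  "nat \<Rightarrow> (letter \<Rightarrow> nat \<Rightarrow> nat \<Rightarrow> complex) \<Rightarrow> (letter \<Rightarrow> letter list \<Rightarrow> nat \<Rightarrow> complex) \<Rightarrow> letter list \<Rightarrow> nat \<Rightarrow> complex"
where
  "lower_part r c \<eta> [] k = 0"
| "lower_part r c \<eta> (a # w) k = \<eta> a w k + (\<Sum>j<r. c a k j * lower_part r c \<eta> w j)"

text \<open>The limiting form of \<open>reentry\<close>, with the sources of the two sides kept
  separate: it is then sesquilinear, and diagonal and cross terms can be isolated.\<close>

primrec reentry_form ::
  "nat \<Rightarrow> (letter \<Rightarrow> nat \<Rightarrow> nat \<Rightarrow> complex) \<Rightarrow> (letter \<Rightarrow> letter list \<Rightarrow> nat \<Rightarrow> complex)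
    \<Rightarrow> (letter \<Rightarrow> letter list \<Rightarrow> nat \<Rightarrow> complex) \<Rightarrow> letter list \<Rightarrow> letter list \<Rightarrow> complex"
where
  "reentry_form r c \<zeta> \<eta> u [] = 0"
| "reentry_form r c \<zeta> \<eta> u (a # w) =
    (\<Sum>k<r. cnj (\<zeta> a u k) * lower_part r c \<eta> w k) + reentry_form r c \<zeta> \<eta> (a # u) w"

lemma lower_part_lincomb:
  "lower_part r c (\<lambda>a w k. z * \<eta>0 a w k + \<eta>1 a w k) w k
    = z * lower_part r c \<eta>0 w k + lower_part r c \<eta>1 w k"
  by (induction w arbitrary: k) (simp_all add: algebra_simps sum.distrib sum_distrib_left)

lemma reentry_form_lincomb:
  fixes \<zeta>0 \<zeta>1 :: "letter \<Rightarrow> letter list \<Rightarrow> nat \<Rightarrow> complex"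
  defines "\<zeta> z \<equiv> (\<lambda>a w k. z * \<zeta>0 a w k + \<zeta>1 a w k)"
  shows "reentry_form r c (\<zeta> z) (\<zeta> z) u w
    = cnj z * z * reentry_form r c \<zeta>0 \<zeta>0 u w + cnj z * reentry_form r c \<zeta>0 \<zeta>1 u w
      + z * reentry_form r c \<zeta>1 \<zeta>0 u w + reentry_form r c \<zeta>1 \<zeta>1 u w"
proof (induction w arbitrary: u)
  case (Cons a w)
  have "(\<Sum>k<r. cnj (\<zeta> z a u k) * lower_part r c (\<zeta> z) w k)
      = (\<Sum>k<r. cnj z * z * (cnj (\<zeta>0 a u k) * lower_part r c \<zeta>0 w k)
          + cnj z * (cnj (\<zeta>0 a u k) * lower_part r c \<zeta>1 w k)
          + z * (cnj (\<zeta>1 a u k) * lower_part r c \<zeta>0 w k) + cnj (\<zeta>1 a u k) * lower_part r c \<zeta>1 w k)"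
    unfolding \<zeta>_def lower_part_lincomb by (intro sum.cong refl) (simp add: algebra_simps)
  then show ?case
    by (simp add: Cons sum.distrib sum_distrib_left[symmetric] distrib_left)
qed simp

text \<open>Emits \<open>f\<close> exactly when the letter \<open>b\<close> is applied to the vector
  of \<open>w\<close>, that is, at the word \<open>b # w\<close>.\<close>

definition path_source :: "letter \<Rightarrow> letter list \<Rightarrow> (nat \<Rightarrow> complex) \<Rightarrow> letter \<Rightarrow> letter list \<Rightarrow> nat \<Rightarrow> complex" where
  "path_source b w f a u k = (if a = b \<and> u = w then f k else 0)"

text \<open>The first \<open>length w + 1\<close> basis vectors form a path along which \<open>w\<close> is read from right to
  left; its endpoints are joined to the remaining \<open>r\<close> basis vectors through \<open>e\<close> and \<open>f\<close>.\<close>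

lemma xy_convex_reentry_form:
  assumes p: "xy_convex p"
    and herm: "\<And>a k j. k < r \<Longrightarrow> j < r \<Longrightarrow> c a j k = cnj (c a k j)"
    and orth: "a0 \<noteq> b \<Longrightarrow> (\<Sum>k<r. cnj (e k) * f k) = 0"
    and \<zeta>: "\<zeta> = (\<lambda>a u k. z * path_source a0 [] e a u k + path_source b w f a u k)"
  shows "0 \<le> (\<Sum>v\<in>Poly_Mapping.keys p. Poly_Mapping.lookup p v * reentry_form r c \<zeta> \<zeta> [] (letters v))"
proof -
  define L where "L = length w"
  define m where "m = Suc L"
  define n where "n = m + r"
  \<comment> \<open>Vertex \<open>i\<close> is reached by the suffix of \<open>w\<close> of length
    \<open>i\<close>, so the edge up from it carries the letter before that suffix.\<close>
  define edge where "edge a i \<longleftrightarrow> i < L \<and> w ! (L - Suc i) = a" for a i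
  define vec where "vec a j k = (if a = a0 \<and> j = 0 then z * e k else 0) + (if a = b \<and> j = L then f k else 0)" for a j k
  define B where "B a i j =
     (if i < m then if j < m then if j = Suc i \<and> edge a i \<or> i = Suc j \<and> edge a j then 1 else 0
                    else cnj (vec a i (j - m))
      else if j < m then vec a j (i - m) else c a (i - m) (j - m))" for a i j
  define B0 where "B0 = (\<lambda>a i j. if min j m \<le> min i m then B a i j else 0)"
  have m: "0 < m" "m \<le> n" by (simp_all add: m_def n_def)
  have hermB: "B a j i = cnj (B a i j)" if "i < n" "j < n" for a i j
  proof (cases "i < m \<or> j < m")
    case False
    then have "i - m < r" "j - m < r" using that by (auto simp: n_def)
    from herm[OF this, of a] False show ?thesis by (simp add: B_def)
  qed (auto simp: B_def)
  have orthB: "(\<Sum>k=m..<n. B LX i k * B LY k j) = 0" if ij: "i < m" "j < m" for i j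
  proof -
    have "(\<Sum>k=m..<n. B LX i k * B LY k j) = (\<Sum>k<r. B LX i (k + m) * B LY (k + m) j)"
      using sum.shift_bounds_nat_ivl[of "\<lambda>k. B LX i k * B LY k j" 0 m r]
      by (simp add: n_def add.commute lessThan_atLeast0)
    also have "\<dots> = (\<Sum>k<r. cnj (vec LX i k) * vec LY j k)"
      using ij by (simp add: B_def)
    \<comment> \<open>If the letters agree, one of the two off-diagonal blocks is zero; otherwise
      the only products left pair \<open>e\<close> with \<open>f\<close>.\<close>
    also have "\<dots> = 0"
    proof (cases "a0 = b")
      case True
      then show ?thesis by (cases b) (simp_all add: vec_def)
    next
      case False
      have 1: "(\<Sum>k<r. cnj z * (cnj (e k) * f k)) = 0" "(\<Sum>k<r. z * cnj (cnj (e k) * f k)) = 0"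
        using orth[OF False] by (simp_all only: sum_distrib_left[symmetric] cnj_sum[symmetric]) auto
      show ?thesis
        using False 1 by (cases a0; cases b; cases "i = 0"; cases "i = L"; cases "j = 0"; cases "j = L")
          (simp_all add: vec_def mult_ac)
    qed
    finally show ?thesis .
  qed
  have B0_upper: "B0 a i j = (if i = Suc j \<and> edge a j then 1 else 0)" if "i < m" for a i j
    using that by (auto simp: B0_def B_def)
  \<comment> \<open>Only upward edges survive in the limit and nothing comes back from outside, so
    the inner part of the vector of a word is one path vertex or zero, for the sizes
    \<open>m\<close> and \<open>n\<close> alike.\<close>
  have col_upper: "word_col q B0 u i = (if u = drop (L - i) w then 1 else 0)" if "i < m" "m \<le> q" for q u i
    using that(1)
  proof (induction u arbitrary: i)
    case Nil
    then show ?case by (auto simp: L_def m_def)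
  next
    case (Cons a u)
    show ?case
    proof (cases i)
      case 0
      have "(\<Sum>j<q. B0 a 0 j * word_col q B0 u j) = 0"
        using m by (intro sum.neutral) (simp add: B0_upper)
      then show ?thesis using 0 by (simp add: L_def)
    next
      case (Suc j)
      have j: "j < L" "j < m" "j < q" using Suc Cons.prems that m_def by auto
      have "(\<Sum>l<q. B0 a i l * word_col q B0 u l) = (\<Sum>l<q. if l = j then (if edge a j then word_col q B0 u j else 0) else 0)"
        using Cons.prems Suc by (intro sum.cong refl) (simp add: B0_upper)
      also have "\<dots> = (if edge a j \<and> u = drop (L - j) w then 1 else 0)"
        unfolding Cons.IH[OF j(2)] using j by auto
      also have "drop (L - Suc j) w = w ! (L - Suc j) # drop (L - j) w"
        using j Cons_nth_drop_Suc[of "L - Suc j" w] by (simp add: L_def Suc_diff_Suc)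
      then have "(edge a j \<and> u = drop (L - j) w) = (a # u = drop (L - i) w)"
        using j Suc by (auto simp: edge_def)
      finally show ?thesis by simp
    qed
  qed
  have source: "(\<Sum>i<m. B0 a (k + m) i * (if u = drop (L - i) w then 1 else 0)) = \<zeta> a u k" for a k u
  proof -
    have "(\<Sum>i<m. B0 a (k + m) i * (if u = drop (L - i) w then 1 else 0))
        = (\<Sum>i<m. (if i = 0 then if a = a0 \<and> u = [] then z * e k else 0 else 0)
            + (if i = L then if a = b \<and> u = w then f k else 0 else 0))"
      by (intro sum.cong refl) (auto simp: B0_def B_def vec_def L_def)
    also have "\<dots> = \<zeta> a u k"
      using m by (simp add: sum.distrib \<zeta> path_source_def m_def)
    finally show ?thesis .
  qed
  have col_lower: "word_col n B0 u (k + m) = lower_part r c \<zeta> u k" if "k < r" for u k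
    using that
  proof (induction u arbitrary: k)
    case (Cons a u)
    have "word_col n B0 (a # u) (k + m) = (\<Sum>i<m. B0 a (k + m) i * word_col n B0 u i)
        + (\<Sum>i=m..<n. B0 a (k + m) i * word_col n B0 u i)"
      using m by (simp add: lessThan_atLeast0 sum.atLeastLessThan_concat)
    also have "(\<Sum>i<m. B0 a (k + m) i * word_col n B0 u i) = \<zeta> a u k"
      using col_upper[OF _ m(2)] by (simp add: source[symmetric])
    also have "(\<Sum>i=m..<n. B0 a (k + m) i * word_col n B0 u i) = (\<Sum>j<r. B0 a (k + m) (j + m) * word_col n B0 u (j + m))"
      using sum.shift_bounds_nat_ivl[of "\<lambda>i. B0 a (k + m) i * word_col n B0 u i" 0 m r]
      by (simp add: n_def add.commute lessThan_atLeast0)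
    also have "\<dots> = (\<Sum>j<r. c a k j * lower_part r c \<zeta> u j)"
      using Cons by (intro sum.cong refl) (simp add: B0_def B_def)
    finally show ?case by simp
  qed (simp add: m_def)
  have eq: "reentry m n B0 u v = reentry_form r c \<zeta> \<zeta> u v" for u v
  proof (induction v arbitrary: u)
    case (Cons a v)
    have "(\<Sum>k=m..<n. cnj (\<Sum>i<m. B0 a k i * word_col m B0 u i) * word_col n B0 v k)
        = (\<Sum>k<r. cnj (\<Sum>i<m. B0 a (k + m) i * word_col m B0 u i) * word_col n B0 v (k + m))"
      using sum.shift_bounds_nat_ivl[of "\<lambda>k. cnj (\<Sum>i<m. B0 a k i * word_col m B0 u i) * word_col n B0 v k" 0 m r]
      by (simp add: n_def add.commute lessThan_atLeast0)
    also have "\<dots> = (\<Sum>k<r. cnj (\<zeta> a u k) * lower_part r c \<zeta> v k)"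
      using col_upper[OF _ order_refl] col_lower by (intro sum.cong refl) (simp add: source[symmetric])
    finally show ?case using Cons by simp
  qed simp
  have "0 \<le> (\<Sum>v\<in>Poly_Mapping.keys p. Poly_Mapping.lookup p v * reentry m n B0 [] (letters v))"
    unfolding B0_def by (rule xy_convex_reentry[OF p m hermB orthB])
  then show ?thesis by (simp only: eq)
qed

section \<open>Words excluded by vanishing diagonal terms\<close>

lemma reentry_form_path_source:
  "reentry_form r c (path_source a0 [] e) \<eta> [] v
    = (case v of [] \<Rightarrow> 0 | a # w \<Rightarrow> if a = a0 then \<Sum>k<r. cnj (e k) * lower_part r c \<eta> w k else 0)"
proof -
  have "reentry_form r c (path_source a0 [] e) \<eta> u v = 0" if "u \<noteq> []" for u v
    using that by (induction v arbitrary: u) (simp_all add: path_source_def)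
  then show ?thesis by (cases v) (simp_all add: path_source_def)
qed

text \<open>Nothing leaves the path before \<open>b # w\<close> has been read.\<close>

lemma lower_part_path_source_short:
  "length u \<le> length w \<Longrightarrow> lower_part r c (path_source b w f) u k = 0"
proof (induction u arbitrary: k)
  case (Cons a u)
  then have "u \<noteq> w" by auto
  then show ?case using Cons by (simp add: path_source_def)
qed simp

text \<open>A nonzero term needs a way out along \<open>b # w\<close> on either side, hence a word
  of length at least \<open>2 * length w + 2\<close>.\<close>

lemma reentry_form_path_source_short:
  "length u + length v < 2 * length w + 2
    \<Longrightarrow> reentry_form r c (path_source b w f) (path_source b w f) u v = 0"
proof (induction v arbitrary: u)
  case (Cons a v)
  have "path_source b w f a u k = 0 \<or> lower_part r c (path_source b w f) v k = 0" for k
  proof (cases "u = w")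
    case True
    then show ?thesis using Cons.prems by (intro disjI2 lower_part_path_source_short) simp
  qed (simp add: path_source_def)
  then have "(\<Sum>k<r. cnj (path_source b w f a u k) * lower_part r c (path_source b w f) v k) = 0"
    by (intro sum.neutral) (metis complex_cnj_zero mult_zero_left mult_zero_right)
  then show ?case using Cons by simp
qed simp

text \<open>In the positive semidefinite form spanned by the two sources, \<open>diag\<close> makes
  one diagonal entry zero, so the off-diagonal entry is zero as well.\<close>

lemma xy_convex_cross_term_zero:
  assumes p: "xy_convex p"
    and herm: "\<And>a k j. k < r \<Longrightarrow> j < r \<Longrightarrow> c a j k = cnj (c a k j)"
    and orth: "a0 \<noteq> b \<Longrightarrow> (\<Sum>k<r. cnj (e k) * f k) = 0"
    and diag: "\<And>v. v \<in> Poly_Mapping.keys p \<Longrightarrow>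
      reentry_form r c (path_source b w f) (path_source b w f) [] (letters v) = 0"
  shows "(\<Sum>v\<in>Poly_Mapping.keys p.
    Poly_Mapping.lookup p v * reentry_form r c (path_source a0 [] e) (path_source b w f) [] (letters v)) = 0"
proof (rule hermitian_quadratic_zero)
  let ?F = "\<lambda>\<zeta> \<eta>. \<Sum>v\<in>Poly_Mapping.keys p. Poly_Mapping.lookup p v * reentry_form r c \<zeta> \<eta> [] (letters v)"
  let ?a = "path_source a0 [] e" and ?b = "path_source b w f"
  fix z
  have "0 \<le> (\<Sum>v\<in>Poly_Mapping.keys p. Poly_Mapping.lookup p v *
      reentry_form r c (\<lambda>a u k. z * ?a a u k + ?b a u k) (\<lambda>a u k. z * ?a a u k + ?b a u k) [] (letters v))"
    by (rule xy_convex_reentry_form[OF p herm orth refl])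
  moreover have "?F ?b ?b = 0" using diag by simp
  ultimately show "0 \<le> cnj z * z * ?F ?a ?a + cnj z * ?F ?a ?b + z * ?F ?b ?a"
    by (simp add: reentry_form_lincomb distrib_left sum.distrib sum_distrib_left mult_ac)
qed

text \<open>A longest word \<open>a0 # g # b # w\<close> is isolated by a cross term:
  \<open>b # w\<close> leads out to \<open>f\<close>, the letter \<open>g\<close> moves
  \<open>f\<close> to \<open>e\<close>, and \<open>a0\<close> leads back to the start. The diagonal
  term needs length \<open>2 * length w + 2\<close>, which exceeds the degree once the degree is at
  least 5.\<close>

lemma xy_convex_degree:
  assumes p: "xy_convex p" and v: "v \<in> Poly_Mapping.keys p"
  shows "length (letters v) \<le> 4"
proof (rule ccontr)
  assume long: "\<not> length (letters v) \<le> 4"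
  define d where "d = Max ((\<lambda>v. length (letters v)) ` Poly_Mapping.keys p)"
  have d: "length (letters u) \<le> d" if "u \<in> Poly_Mapping.keys p" for u
    using that by (simp add: d_def)
  have "d \<in> (\<lambda>v. length (letters v)) ` Poly_Mapping.keys p"
    using v unfolding d_def by (intro Max_in) auto
  then obtain v0 where v0: "v0 \<in> Poly_Mapping.keys p" "length (letters v0) = d" by auto
  have d5: "5 \<le> d" using d[OF v] long by simp
  then obtain a0 g b w where w: "letters v0 = a0 # g # b # w"
  proof -
    have "Suc (Suc (Suc 0)) \<le> length (letters v0)" using v0(2) d5 by simp
    then show ?thesis using that by (auto simp: Suc_le_length_iff)
  qed
  have len: "d = length w + 3" using w v0(2) by simp
  \<comment> \<open>With two outer dimensions, \<open>e\<close> and \<open>f\<close> are distinct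
    unit vectors, orthogonal so that \<open>a0 \<noteq> b\<close> is admissible, and the letter
    \<open>g\<close> exchanges them.\<close>
  define c where "c a k j = (if a = g \<and> k \<noteq> j then 1 else 0 :: complex)" for a and k j :: nat
  define e where "e k = (if k = 0 then 1 else 0 :: complex)" for k :: nat
  define f where "f k = (if k = 0 then 0 else 1 :: complex)" for k :: nat
  let ?f = "path_source b w f"
  have low1: "lower_part 2 c ?f (a # u) k = ?f a u k" if "length u = length w" for a u k
    using that by (simp add: lower_part_path_source_short)
  \<comment> \<open>Up to this length, \<open>g # b # w\<close> is the only word with a component
    along \<open>e\<close>.\<close>
  have low: "lower_part 2 c ?f u 0 = (if u = g # b # w then 1 else 0)" if "length u \<le> length w + 2" for u
  proof (cases "length u \<le> length w")
    case True
    then show ?thesis by (auto simp: lower_part_path_source_short)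
  next
    case False
    then obtain a u' where u: "u = a # u'" by (cases u) auto
    show ?thesis
    proof (cases "length u' = length w")
      case True
      then show ?thesis unfolding u low1[OF True] by (auto simp: path_source_def f_def)
    next
      case False': False
      then have "length u' = Suc (length w)" using False that u by simp
      then obtain a' u'' where u': "u' = a' # u''" "length u'' = length w"
        by (auto simp: length_Suc_conv)
      have "lower_part 2 c ?f u 0 = c a 0 1 * ?f a' u'' 1"
        using u' False' unfolding u u' lower_part.simps(2)[of _ _ _ a] low1[OF u'(2)]
        by (auto simp: path_source_def c_def lessThan_Suc numeral_2_eq_2)
      then show ?thesis by (auto simp: u u' c_def path_source_def f_def)
    qed
  qed
  have "(\<Sum>v\<in>Poly_Mapping.keys p. Poly_Mapping.lookup p v *
      reentry_form 2 c (path_source a0 [] e) ?f [] (letters v)) = 0"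
  proof (rule xy_convex_cross_term_zero[OF p])
    fix u assume "u \<in> Poly_Mapping.keys p"
    then show "reentry_form 2 c ?f ?f [] (letters u) = 0"
      using d[of u] d5 len by (intro reentry_form_path_source_short) simp
  qed (auto simp: c_def e_def f_def lessThan_Suc numeral_2_eq_2)
  also have "(\<Sum>v\<in>Poly_Mapping.keys p. Poly_Mapping.lookup p v *
      reentry_form 2 c (path_source a0 [] e) ?f [] (letters v))
      = (\<Sum>v\<in>Poly_Mapping.keys p. if v = v0 then Poly_Mapping.lookup p v else 0)"
  proof (rule sum.cong[OF refl])
    fix u assume u: "u \<in> Poly_Mapping.keys p"
    have eq: "u = v0 \<longleftrightarrow> letters u = a0 # g # b # w" using w by (metis word.expand)
    have "(\<Sum>k<2. cnj (e k) * lower_part 2 c ?f t k) = lower_part 2 c ?f t 0" for t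
      by (simp add: e_def lessThan_Suc numeral_2_eq_2 del: lower_part.simps)
    then show "Poly_Mapping.lookup p u * reentry_form 2 c (path_source a0 [] e) ?f [] (letters u)
        = (if u = v0 then Poly_Mapping.lookup p u else 0)"
      using d[OF u] len unfolding reentry_form_path_source eq
      by (cases "letters u") (auto simp: low simp del: lower_part.simps)
  qed
  also have "\<dots> = Poly_Mapping.lookup p v0" using v0 by simp
  finally show False using v0 by (simp add: in_keys_iff)
qed

text \<open>With the same letter at both ends the other matrix has no off-diagonal part, so one
  outer vector with zero block is admissible: the word leaves through \<open>a # w\<close>, and the
  next \<open>a\<close> returns to the start at once.\<close>

lemma xy_convex_square_prefix:
  assumes p: "xy_convex p"
    and diag: "\<And>v. v \<in> Poly_Mapping.keys p \<Longrightarrow>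
      reentry_form 1 (\<lambda>_ _ _. 0) (path_source a w (\<lambda>_. 1)) (path_source a w (\<lambda>_. 1)) [] (letters v) = 0"
  shows "Poly_Mapping.lookup p (Word (a # a # w)) = 0"
proof -
  let ?f = "path_source a w (\<lambda>_. 1)"
  have low: "lower_part 1 (\<lambda>_ _ _. 0) ?f u k = (if u = a # w then 1 else 0)" for u k
    by (cases u) (auto simp: path_source_def)
  have "(\<Sum>v\<in>Poly_Mapping.keys p. Poly_Mapping.lookup p v *
      reentry_form 1 (\<lambda>_ _ _. 0) (path_source a [] (\<lambda>_. 1)) ?f [] (letters v)) = 0"
    by (rule xy_convex_cross_term_zero[OF p]) (use diag in auto)
  also have "(\<Sum>v\<in>Poly_Mapping.keys p. Poly_Mapping.lookup p v *
      reentry_form 1 (\<lambda>_ _ _. 0) (path_source a [] (\<lambda>_. 1)) ?f [] (letters v))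
      = (\<Sum>v\<in>Poly_Mapping.keys p. if v = Word (a # a # w) then Poly_Mapping.lookup p v else 0)"
  proof (rule sum.cong[OF refl])
    fix v show "Poly_Mapping.lookup p v * reentry_form 1 (\<lambda>_ _ _. 0) (path_source a [] (\<lambda>_. 1)) ?f [] (letters v)
        = (if v = Word (a # a # w) then Poly_Mapping.lookup p v else 0)"
      unfolding reentry_form_path_source low by (cases v; cases "letters v") auto
  qed
  also have "\<dots> = Poly_Mapping.lookup p (Word (a # a # w))"
    by (simp add: in_keys_iff)
  finally show ?thesis .
qed

text \<open>The diagonal term for \<open>w = [b, c]\<close> needs a word of length 6, beyond the
  degree bound.\<close>

lemma xy_convex_no_square_prefix_4:
  assumes p: "xy_convex p"
  shows "Poly_Mapping.lookup p (Word [a, a, b, c]) = 0"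
proof (rule xy_convex_square_prefix[OF p])
  fix v assume "v \<in> Poly_Mapping.keys p"
  then show "reentry_form 1 (\<lambda>_ _ _. 0) (path_source a [b, c] (\<lambda>_. 1)) (path_source a [b, c] (\<lambda>_. 1)) [] (letters v) = 0"
    using xy_convex_degree[OF p, of v] by (intro reentry_form_path_source_short) simp
qed

text \<open>The diagonal term for \<open>w = [a]\<close> could only come from
  \<open>[a, a, a, a]\<close>, which \<open>xy_convex_no_square_prefix_4\<close> excludes.\<close>

lemma xy_convex_no_cube:
  assumes p: "xy_convex p"
  shows "Poly_Mapping.lookup p (Word [a, a, a]) = 0"
proof (rule xy_convex_square_prefix[OF p])
  fix v assume v: "v \<in> Poly_Mapping.keys p"
  let ?R = "reentry_form 1 (\<lambda>_ _ _. 0) (path_source a [a] (\<lambda>_. 1)) (path_source a [a] (\<lambda>_. 1))"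
  show "?R [] (letters v) = 0"
  proof (cases "length (letters v) = 4")
    case True
    then obtain b1 b2 b3 b4 where b: "letters v = [b1, b2, b3, b4]"
      by (auto simp: length_Suc_conv numeral_eq_Suc)
    have "v \<noteq> Word [a, a, a, a]"
      using v xy_convex_no_square_prefix_4[OF p, of a a a] by (auto simp: in_keys_iff)
    then have "[b1, b2, b3, b4] \<noteq> [a, a, a, a]" using b by (metis word.collapse)
    then show ?thesis by (auto simp: b path_source_def)
  next
    case False
    then show ?thesis
      using xy_convex_degree[OF p v] by (intro reentry_form_path_source_short) simp
  qed
qed

section \<open>Duality\<close>

text \<open>Cholesky factorization by induction: split off the last index and factor the Schur
  complement \<open>H'\<close>.\<close>

lemma positive_definite_gram:
  fixes H :: "nat \<Rightarrow> nat \<Rightarrow> complex"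
  assumes herm: "\<And>i j. i < n \<Longrightarrow> j < n \<Longrightarrow> H j i = cnj (H i j)"
    and pd: "\<And>v. \<exists>i<n. v i \<noteq> 0 \<Longrightarrow> 0 < Re (\<Sum>i<n. \<Sum>j<n. cnj (v i) * H i j * v j)"
  shows "\<exists>f. \<forall>i<n. \<forall>j<n. H i j = (\<Sum>k<n. cnj (f i k) * f j k)"
  using assms
proof (induction n arbitrary: H)
  case (Suc n)
  define a where "a = Re (H n n)"
  have "(\<Sum>i<Suc n. \<Sum>j<Suc n. cnj (if i = n then 1 else 0) * H i j * (if j = n then 1 else 0)) = H n n"
    by (simp add: lessThan_Suc if_distrib[of cnj] if_distrib[of "\<lambda>x. x * _"] if_distrib[of "\<lambda>x. _ * x"] cong: if_cong)
  then have a: "0 < a"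
    using Suc.prems(2)[of "\<lambda>i. if i = n then 1 else 0"] by (auto simp: a_def)
  have "H n n = cnj (H n n)" by (rule Suc.prems(1)) auto
  then have Hnn: "H n n = of_real a"
    by (auto simp: a_def complex_eq_iff)
  define H' where "H' i j = H i j - H i n * H n j / of_real a" for i j
  have "\<exists>f. \<forall>i<n. \<forall>j<n. H' i j = (\<Sum>k<n. cnj (f i k) * f j k)"
  proof (rule Suc.IH)
    fix i j assume "i < n" "j < n"
    then show "H' j i = cnj (H' i j)"
      using Suc.prems(1)[of i j] Suc.prems(1)[of n i] Suc.prems(1)[of n j] by (simp add: H'_def)
  next
    fix v :: "nat \<Rightarrow> complex" assume v: "\<exists>i<n. v i \<noteq> 0"
    define b where "b = (\<Sum>j<n. H n j * v j)"
    \<comment> \<open>The last coordinate minimizes the form of \<open>H\<close> for given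
      \<open>v\<close>; the minimum is the form of \<open>H'\<close> at \<open>v\<close>.\<close>
    define u where "u i = (if i = n then - b / of_real a else v i)" for i
    have uv: "u i = v i" if "i < n" for i using that by (simp add: u_def)
    have cnj_b: "(\<Sum>i<n. cnj (v i) * H i n) = cnj b"
      unfolding b_def cnj_sum using Suc.prems(1)[of n] by (intro sum.cong refl) simp
    have "(\<Sum>i<Suc n. \<Sum>j<Suc n. cnj (u i) * H i j * u j)
        = (\<Sum>i<n. \<Sum>j<n. cnj (v i) * H i j * v j) + (\<Sum>i<n. cnj (v i) * H i n) * u n
          + cnj (u n) * b + cnj (u n) * H n n * u n"
      by (simp add: uv b_def sum.distrib sum_distrib_left sum_distrib_right mult.assoc)
    also have "\<dots> = (\<Sum>i<n. \<Sum>j<n. cnj (v i) * H i j * v j) - cnj b * b / of_real a"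
      using a unfolding cnj_b by (simp add: u_def Hnn)
    also have "cnj b * b / of_real a = (\<Sum>i<n. \<Sum>j<n. cnj (v i) * (H i n * H n j / of_real a) * v j)"
      unfolding cnj_b[symmetric] unfolding b_def sum_product sum_divide_distrib
      by (intro sum.cong refl) (simp add: mult_ac)
    also have "(\<Sum>i<n. \<Sum>j<n. cnj (v i) * H i j * v j) - \<dots> = (\<Sum>i<n. \<Sum>j<n. cnj (v i) * H' i j * v j)"
      unfolding H'_def by (simp only: sum_subtractf[symmetric] left_diff_distrib right_diff_distrib)
    finally show "0 < Re (\<Sum>i<n. \<Sum>j<n. cnj (v i) * H' i j * v j)"
      using Suc.prems(2)[of u] v by (metis less_Suc_eq nat_neq_iff u_def)
  qed
  then obtain f where f: "\<And>i j. i < n \<Longrightarrow> j < n \<Longrightarrow> H' i j = (\<Sum>k<n. cnj (f i k) * f j k)" by blast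
  \<comment> \<open>The old vectors gain one coordinate that restores the subtracted term; the new
    vector lies along that coordinate.\<close>
  define g where "g i k = (if i < n then if k < n then f i k else H n i / of_real (sqrt a)
    else if k < n then 0 else of_real (sqrt a))" for i k
  have sqrt_a: "complex_of_real (sqrt a) * complex_of_real (sqrt a) = of_real a" "complex_of_real (sqrt a) \<noteq> 0"
    using a by (simp_all flip: of_real_mult)
  have "H i j = (\<Sum>k<Suc n. cnj (g i k) * g j k)" if ij: "i < Suc n" "j < Suc n" for i j
  proof -
    consider "i < n" "j < n" | "i < n" "j = n" | "i = n" "j < n" | "i = n" "j = n"
      using ij by linarith
    then show ?thesis
    proof cases
      case 1
      have "H i j = H' i j + cnj (H n i) * H n j / of_real a"
        using 1 Suc.prems(1)[of n i] by (simp add: H'_def)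
      then show ?thesis using 1 f[of i j] by (simp add: g_def sqrt_a)
    next
      case 2
      then show ?thesis using sqrt_a Suc.prems(1)[of n i] by (simp add: g_def)
    next
      case 3
      then show ?thesis using sqrt_a by (simp add: g_def)
    next
      case 4
      then show ?thesis using sqrt_a Hnn by (simp add: g_def)
    qed
  qed
  then show ?case by blast
qed simp

text \<open>A hermitian \<open>c\<close> that maps \<open>f\<close> to \<open>g\<close> makes their
  inner product real; for nonzero \<open>f\<close> this is the only obstruction.\<close>

lemma hermitian_interpolation:
  fixes f g :: "nat \<Rightarrow> complex"
  assumes f: "(\<Sum>k<r. cnj (f k) * f k) \<noteq> 0" and real: "Im (\<Sum>k<r. cnj (f k) * g k) = 0"
  obtains c where "\<And>k j. c j k = cnj (c k j)" "\<And>k. (\<Sum>j<r. c k j * f j) = g k"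
proof
  define s where "s = (\<Sum>k<r. cnj (f k) * f k)"
  define t where "t = (\<Sum>k<r. cnj (f k) * g k)"
  have s: "s \<noteq> 0" "cnj s = s" using f by (simp_all add: s_def mult.commute)
  have "Im t = 0" using real by (simp only: t_def)
  then have t: "cnj t = t" by (simp add: complex_eq_iff)
  \<comment> \<open>The symmetrized first term sends \<open>f\<close> to \<open>g\<close> plus an
    error along \<open>f\<close>; the last term removes that error.\<close>
  let ?c = "\<lambda>k j. (g k * cnj (f j) + f k * cnj (g j)) / s - t * f k * cnj (f j) / (s * s)"
  show "?c j k = cnj (?c k j)" for k j
    by (simp add: s t algebra_simps)
  fix k
  have "(\<Sum>j<r. ?c k j * f j) = (\<Sum>j<r. g k / s * (cnj (f j) * f j) + f k / s * cnj (cnj (f j) * g j)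
      - t * f k / (s * s) * (cnj (f j) * f j))"
    by (intro sum.cong refl) (simp add: algebra_simps add_divide_distrib diff_divide_distrib)
  also have "\<dots> = g k / s * s + f k / s * cnj t - t * f k / (s * s) * s"
    unfolding s_def t_def cnj_sum sum_distrib_left by (simp add: sum.distrib sum_subtractf)
  also have "\<dots> = g k" using s by (simp add: t)
  finally show "(\<Sum>j<r. ?c k j * f j) = g k" .
qed

text \<open>The functional \<open>u\<close> keeps 0 out of the convex hull, so the cone is closed
  and \<open>g\<close> can be separated from it. Adding a small multiple of \<open>u\<close> makes
  the separating functional strictly positive on \<open>K\<close>.\<close>

lemma conic_hull_separation:
  fixes K :: "'a::euclidean_space set"
  assumes K: "compact K" and ne: "K \<noteq> {}" and u: "\<And>x. x \<in> K \<Longrightarrow> inner u x = 1"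
    and g: "g \<notin> conic hull (convex hull K)"
  obtains a where "inner a g < 0" "\<And>x. x \<in> K \<Longrightarrow> 0 < inner a x"
proof -
  let ?C = "conic hull (convex hull K)"
  have "convex hull K \<subseteq> {x. inner u x = 1}"
    using u by (intro hull_minimal) (auto intro: convex_hyperplane)
  then have "0 \<notin> convex hull K" by auto
  then have closed: "closed ?C"
    using compact_convex_hull[OF K] by (intro closed_conic_hull) auto
  have "convex ?C" by (simp add: convex_conic_hull)
  from separating_hyperplane_closed_point[OF this closed g]
  obtain a b where a: "inner a g < b" "\<And>x. x \<in> ?C \<Longrightarrow> b < inner a x" by blast
  have scale: "t *\<^sub>R x \<in> ?C" if "x \<in> K" "0 \<le> t" for t x
    using that by (metis conic_conic_hull conic_def hull_inc)
  obtain x0 where x0: "x0 \<in> K" using ne by blast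
  then have b: "b < 0" using a(2)[OF scale[of x0 0]] by simp
  have nonneg: "0 \<le> inner a x" if x: "x \<in> K" for x
  proof (rule ccontr)
    assume neg: "\<not> 0 \<le> inner a x"
    \<comment> \<open>Otherwise a multiple of \<open>x\<close> in the cone attains the value
      \<open>b\<close>.\<close>
    then have "b < inner a ((b / inner a x) *\<^sub>R x)"
      using b by (intro a(2) scale[OF x]) (simp add: zero_le_divide_iff)
    then show False using neg by simp
  qed
  \<comment> \<open>The value at \<open>g\<close> rises by at most half of its distance to
    0.\<close>
  define e where "e = - inner a g / (2 * (\<bar>inner u g\<bar> + 1))"
  have e: "0 < e" unfolding e_def using a(1) b by (intro divide_pos_pos) auto
  have "e * inner u g \<le> e * (\<bar>inner u g\<bar> + 1)" using e by (intro mult_left_mono) auto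
  also have "\<dots> = - inner a g / 2" by (simp add: e_def field_simps)
  finally have "inner (a + e *\<^sub>R u) g < 0" using a(1) b by (simp add: inner_add_left)
  moreover have "0 < inner (a + e *\<^sub>R u) x" if "x \<in> K" for x
    using nonneg[OF that] u[OF that] e by (simp add: inner_add_left)
  ultimately show thesis by (rule that)
qed

section \<open>The cone of Gram data\<close>

type_synonym gram_data =
  "real \<times> real \<times> real \<times> real \<times> real \<times> real \<times> complex \<times> complex \<times> complex"

text \<open>The part of the Gram matrix of \<open>(x, y, x y, y x)\<close> that the polynomial determines: the
  coefficient of \<open>x y\<close> is free because of the pencil, and the coefficients of \<open>x y x\<close> and \<open>y x y\<close>
  determine only twice the real part of an entry.\<close>

fun gram_vec :: "complex \<times> complex \<times> complex \<times> complex \<Rightarrow> gram_data" where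
  "gram_vec (v0, v1, v2, v3) = ((cmod v0)\<^sup>2, (cmod v1)\<^sup>2, (cmod v2)\<^sup>2, (cmod v3)\<^sup>2,
     2 * Re (cnj v0 * v3), 2 * Re (cnj v1 * v2), cnj v0 * v2, cnj v1 * v3, cnj v2 * v3)"

text \<open>By quadratic homogeneity nonnegative weights are absorbed into the vectors, so
  unweighted sums of \<open>gram_vec\<close> values already form a cone.\<close>

lemma gram_vec_scaleR: "0 \<le> t \<Longrightarrow> gram_vec (sqrt t *\<^sub>R v) = t *\<^sub>R gram_vec v"
proof (cases v)
  case (fields v0 v1 v2 v3)
  assume t: "0 \<le> t"
  have "cnj (of_real (sqrt t) * x) * (of_real (sqrt t) * y) = of_real t * (cnj x * y)" for x y
  proof -
    have "cnj (of_real (sqrt t) * x) * (of_real (sqrt t) * y) = of_real (sqrt t * sqrt t) * (cnj x * y)"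
      by (simp only: of_real_mult complex_cnj_mult complex_cnj_complex_of_real mult_ac)
    then show ?thesis using t by simp
  qed
  moreover have "(cmod (of_real (sqrt t) * x))\<^sup>2 = t * (cmod x)\<^sup>2" for x
    using t by (simp add: norm_mult power_mult_distrib)
  moreover have "Re (of_real t * x) = t * Re x" for x by simp
  ultimately show ?thesis
    by (simp only: fields gram_vec.simps scaleR_Pair scaleR_conv_of_real[where 'a=complex] real_scaleR_def mult.left_commute[of t])
qed

lemma gram_vec_nonzero_pos:
  assumes a: "\<And>x. x \<in> gram_vec ` sphere 0 1 \<Longrightarrow> 0 < inner a x" and v: "v \<noteq> 0"
  shows "0 < inner a (gram_vec v)"
proof -
  let ?t = "norm v ^ 2"
  have "v = sqrt ?t *\<^sub>R (v /\<^sub>R norm v)" using v by simp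
  then have "gram_vec v = ?t *\<^sub>R gram_vec (v /\<^sub>R norm v)" by (metis gram_vec_scaleR zero_le_power2)
  moreover have "0 < inner a (gram_vec (v /\<^sub>R norm v))" using v by (intro a) auto
  ultimately show ?thesis using v by simp
qed

text \<open>The sums of \<open>gram_vec\<close> values form a convex cone that contains the cone
  over the image of the unit sphere, so separation from the latter applies.\<close>

lemma gram_data_separation:
  assumes g: "\<nexists>vs. g = sum_list (map gram_vec vs)"
  obtains a where "inner a g < 0" "\<And>v. v \<noteq> 0 \<Longrightarrow> 0 < inner a (gram_vec v)"
proof -
  let ?K = "gram_vec ` sphere 0 1"
  let ?S = "range (\<lambda>vs. sum_list (map gram_vec vs))"
  have "continuous_on UNIV (\<lambda>v. gram_vec (fst v, fst (snd v), fst (snd (snd v)), snd (snd (snd v))))"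
    unfolding gram_vec.simps by (intro continuous_intros)
  then have "continuous_on UNIV gram_vec" by (simp only: prod.collapse)
  then have K: "compact ?K"
    by (intro compact_continuous_image compact_sphere) (rule continuous_on_subset, auto)
  \<comment> \<open>The trace of the Gram matrix, which is 1 on the image of the unit
    sphere.\<close>
  define u :: gram_data where "u = (1, 1, 1, 1, 0, 0, 0, 0, 0)"
  have u: "inner u x = 1" if "x \<in> ?K" for x
  proof -
    obtain v where v: "norm v = 1" "x = gram_vec v" using \<open>x \<in> ?K\<close> by auto
    have "inner u (gram_vec v) = norm v ^ 2"
      by (cases v) (simp add: u_def norm_Pair)
    then show ?thesis using v by simp
  qed
  have add: "x + y \<in> ?S" if xy: "x \<in> ?S" "y \<in> ?S" for x y
  proof -
    obtain vs ws where "x = sum_list (map gram_vec vs)" "y = sum_list (map gram_vec ws)" using xy by auto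
    then have "x + y = sum_list (map gram_vec (vs @ ws))" by simp
    then show ?thesis by (rule range_eqI)
  qed
  have scale: "t *\<^sub>R x \<in> ?S" if x: "x \<in> ?S" and t: "0 \<le> t" for x t
  proof -
    obtain vs where "x = sum_list (map gram_vec vs)" using x by auto
    moreover have "t *\<^sub>R sum_list (map gram_vec vs) = sum_list (map gram_vec (map (\<lambda>v. sqrt t *\<^sub>R v) vs))"
      using t by (induction vs) (simp_all add: scaleR_add_right gram_vec_scaleR)
    ultimately have "t *\<^sub>R x = sum_list (map gram_vec (map (\<lambda>v. sqrt t *\<^sub>R v) vs))" by simp
    then show ?thesis by (rule range_eqI)
  qed
  have "?K \<subseteq> ?S"
  proof
    fix x assume "x \<in> ?K"
    then obtain v where "x = gram_vec v" by auto
    then have "x = sum_list (map gram_vec [v])" by simp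
    then show "x \<in> ?S" by (rule range_eqI)
  qed
  moreover have "convex ?S" unfolding convex_def by (intro ballI allI impI add scale)
  ultimately have "convex hull ?K \<subseteq> ?S" by (rule hull_minimal)
  moreover have "conic ?S" unfolding conic_def by (intro allI impI scale) auto
  ultimately have "conic hull (convex hull ?K) \<subseteq> ?S" by (rule hull_minimal)
  then have "g \<notin> conic hull (convex hull ?K)" using g by blast
  moreover have "(1, 0, 0, 0) \<in> sphere (0 :: complex \<times> complex \<times> complex \<times> complex) 1"
    by (simp add: norm_Pair)
  then have "?K \<noteq> {}" by blast
  ultimately obtain a where a: "inner a g < 0" "\<And>x. x \<in> ?K \<Longrightarrow> 0 < inner a x"
    using conic_hull_separation[OF K _ u] by metis
  show thesis
    by (rule that[OF a(1)]) (rule gram_vec_nonzero_pos[OF a(2)])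
qed

section \<open>The sum of squares\<close>

text \<open>The words \<open>rev u @ v\<close> with \<open>u\<close> and \<open>v\<close> among
  \<open>[]\<close>, \<open>[LX]\<close>, \<open>[LY]\<close>, \<open>[LX, LY]\<close>,
  \<open>[LY, LX]\<close>, listed for case analysis.\<close>

definition pencil_products :: "letter list set" where
  "pencil_products = {[], [LX], [LY], [LX, LX], [LX, LY], [LY, LX], [LY, LY],
    [LX, LX, LY], [LX, LY, LX], [LX, LY, LY], [LY, LX, LX], [LY, LX, LY], [LY, LY, LX],
    [LX, LY, LX, LY], [LX, LY, LY, LX], [LY, LX, LX, LY], [LY, LX, LY, LX]}"

lemma lookup_rev_symmetric:
  assumes "nc_symmetric p"
  shows "Poly_Mapping.lookup p (Word (rev w)) = cnj (Poly_Mapping.lookup p (Word w))"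
  using assms lookup_nc_star[of p "Word (rev w)"] by (simp add: nc_symmetric_def)

lemma xy_convex_keys:
  assumes sym: "nc_symmetric p" and p: "xy_convex p" and v: "Word v \<in> Poly_Mapping.keys p"
  shows "v \<in> pencil_products"
proof -
  have nz: "Poly_Mapping.lookup p (Word v) \<noteq> 0" using v by (simp add: in_keys_iff)
  have cube: "v \<noteq> [a, a, a]" for a
    using nz xy_convex_no_cube[OF p] by metis
  have prefix: "v \<noteq> [a, a, b, c]" for a b c
    using nz xy_convex_no_square_prefix_4[OF p] by metis
  \<comment> \<open>Symmetry of \<open>p\<close> turns the excluded prefix into an excluded
    suffix.\<close>
  have suffix: "v \<noteq> [b, c, a, a]" for a b c
  proof
    assume "v = [b, c, a, a]"
    then have "Poly_Mapping.lookup p (Word (rev [a, a, c, b])) \<noteq> 0" using nz by simp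
    then show False
      unfolding lookup_rev_symmetric[OF sym] xy_convex_no_square_prefix_4[OF p] by simp
  qed
  have "length v \<le> 4" using xy_convex_degree[OF p v] by simp
  then consider "length v = 0" | "length v = 1" | "length v = 2" | "length v = 3" | "length v = 4"
    by linarith
  then show ?thesis
  proof cases
    case 2
    then obtain a where "v = [a]" by (auto simp: length_Suc_conv)
    then show ?thesis by (cases a) (simp_all add: pencil_products_def)
  next
    case 3
    then obtain a b where "v = [a, b]" by (auto simp: length_Suc_conv numeral_eq_Suc)
    then show ?thesis by (cases a; cases b) (simp_all add: pencil_products_def)
  next
    case 4
    then obtain a b c where abc: "v = [a, b, c]" by (auto simp: length_Suc_conv numeral_eq_Suc)
    have "\<not> (a = b \<and> b = c)" using cube[of a] abc by auto
    then show ?thesis unfolding abc by (cases a; cases b; cases c) (simp_all add: pencil_products_def)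
  next
    case 5
    then obtain a b c d where abcd: "v = [a, b, c, d]" by (auto simp: length_Suc_conv numeral_eq_Suc)
    have "a \<noteq> b" "c \<noteq> d" using prefix[of a c d] suffix[of a b c] abcd by auto
    then show ?thesis unfolding abcd
      by (cases a; cases b; cases c; cases d) (simp_all add: pencil_products_def)
  qed (simp add: pencil_products_def)
qed

text \<open>Replaces the unknown support of \<open>p\<close> by a fixed finite set, so that
  positivity becomes an explicit inequality.\<close>

lemma sum_keys_pencil_products:
  assumes sym: "nc_symmetric p" and p: "xy_convex p"
  shows "(\<Sum>v\<in>Poly_Mapping.keys p. Poly_Mapping.lookup p v * F (letters v))
    = (\<Sum>v\<in>pencil_products. Poly_Mapping.lookup p (Word v) * F v)"
proof -
  have "(\<Sum>v\<in>Poly_Mapping.keys p. Poly_Mapping.lookup p v * F (letters v))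
      = (\<Sum>v\<in>Word ` pencil_products. Poly_Mapping.lookup p v * F (letters v))"
  proof (rule sum.mono_neutral_left)
    show "Poly_Mapping.keys p \<subseteq> Word ` pencil_products"
    proof
      fix v assume v: "v \<in> Poly_Mapping.keys p"
      obtain u where u: "v = Word u" by (cases v)
      show "v \<in> Word ` pencil_products"
        using xy_convex_keys[OF sym p, of u] v by (simp add: u)
    qed
  qed (auto simp: pencil_products_def in_keys_iff)
  also have "\<dots> = (\<Sum>v\<in>pencil_products. Poly_Mapping.lookup p (Word v) * F v)"
    by (simp add: sum.reindex inj_on_def)
  finally show ?thesis .
qed

text \<open>Compressing to a one-dimensional space with \<open>X\<close> and \<open>Y\<close> vanishing there, the vectors \<open>f 0\<close>,
  \<open>f 1\<close>, \<open>f 2 = c f 1\<close>, \<open>f 3 = d f 0\<close> become the images of \<open>x\<close>, \<open>y\<close>, \<open>x y\<close>, \<open>y x\<close> outside it. The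
  matrices \<open>c\<close> and \<open>d\<close> can be chosen hermitian because \<open>H 1 2\<close> and \<open>H 0 3\<close> are real.\<close>

lemma xy_convex_gram_nonneg:
  fixes H :: "nat \<Rightarrow> nat \<Rightarrow> complex"
  assumes sym: "nc_symmetric p" and p: "xy_convex p"
    and herm: "\<And>i j. i < 4 \<Longrightarrow> j < 4 \<Longrightarrow> H j i = cnj (H i j)"
    and pd: "\<And>v. \<exists>i<4. v i \<noteq> 0 \<Longrightarrow> 0 < Re (\<Sum>i<4. \<Sum>j<4. cnj (v i) * H i j * v j)"
    and H01: "H 0 1 = 0" and H03: "Im (H 0 3) = 0" and H12: "Im (H 1 2) = 0"
  defines "P w \<equiv> Poly_Mapping.lookup p (Word w)"
  shows "0 \<le> P [LX, LX] * H 0 0 + P [LY, LY] * H 1 1 + P [LY, LX, LX, LY] * H 2 2 + P [LX, LY, LY, LX] * H 3 3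
    + P [LX, LX, LY] * H 0 2 + P [LY, LX, LX] * H 2 0 + P [LX, LY, LX] * H 0 3 + P [LY, LX, LY] * H 1 2
    + P [LY, LY, LX] * H 1 3 + P [LX, LY, LY] * H 3 1 + P [LY, LX, LY, LX] * H 2 3 + P [LX, LY, LX, LY] * H 3 2"
proof -
  obtain f :: "nat \<Rightarrow> nat \<Rightarrow> complex" where f: "\<And>i j. i < 4 \<Longrightarrow> j < 4 \<Longrightarrow> H i j = (\<Sum>k<4. cnj (f i k) * f j k)"
    using positive_definite_gram[of 4 H, OF herm pd] by metis
  \<comment> \<open>For the interpolation \<open>f 0\<close> and \<open>f 1\<close> must be
    nonzero.\<close>
  have diag: "H i i \<noteq> 0" if i: "i < 4" for i
  proof -
    have "(\<Sum>k<4. \<Sum>l<4. cnj (if k = i then 1 else 0) * H k l * (if l = i then 1 else 0)) = H i i"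
      using i by (simp add: if_distrib[of cnj] if_distrib[of "\<lambda>x. x * _"] if_distrib[of "\<lambda>x. _ * x"] cong: if_cong)
    moreover have "\<exists>k<4. (if k = i then 1 else 0 :: complex) \<noteq> 0" using i by auto
    ultimately show ?thesis using pd[of "\<lambda>k. if k = i then 1 else 0"] by force
  qed
  have inner_f: "(\<Sum>k<4. cnj (f i k) * f j k) = H i j" if "i < 4" "j < 4" for i j
    by (rule f[OF that, symmetric])
  have "(\<Sum>k<4. cnj (f 1 k) * f 1 k) \<noteq> 0" "Im (\<Sum>k<4. cnj (f 1 k) * f 2 k) = 0"
    using inner_f[of 1 1] inner_f[of 1 2] diag[of 1] H12 by simp_all
  then obtain c where c: "\<And>k j. c j k = cnj (c k j)" "\<And>k. (\<Sum>j<4. c k j * f 1 j) = f 2 k"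
    by (rule hermitian_interpolation) (rule that)
  have "(\<Sum>k<4. cnj (f 0 k) * f 0 k) \<noteq> 0" "Im (\<Sum>k<4. cnj (f 0 k) * f 3 k) = 0"
    using inner_f[of 0 0] inner_f[of 0 3] diag[of 0] H03 by simp_all
  then obtain d where d: "\<And>k j. d j k = cnj (d k j)" "\<And>k. (\<Sum>j<4. d k j * f 0 j) = f 3 k"
    by (rule hermitian_interpolation) (rule that)
  define M where "M a = (case a of LX \<Rightarrow> c | LY \<Rightarrow> d)" for a
  have M_herm: "M a j k = cnj (M a k j)" for a j k
    by (cases a) (simp_all add: M_def c(1)[symmetric] d(1)[symmetric])
  \<comment> \<open>Both sources sit at the empty word, so the inner space has dimension one;
    \<open>H 0 1 = 0\<close> makes the configuration admissible.\<close>
  define \<zeta> where "\<zeta> = (\<lambda>a u k. 1 * path_source LX [] (f 0) a u k + path_source LY [] (f 1) a u k)"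
  define s where "s a = (case a of LX \<Rightarrow> f 0 | LY \<Rightarrow> f 1)" for a
  have \<zeta>: "\<zeta> a u k = (if u = [] then s a k else 0)" for a u k
    by (cases a) (simp_all add: \<zeta>_def path_source_def s_def)
  have self_adjoint: "(\<Sum>k<4. cnj (u k) * (\<Sum>j<4. e k j * v j)) = (\<Sum>k<4. cnj (\<Sum>j<4. e k j * u j) * v k)"
    if e: "\<And>k j. e j k = cnj (e k j)" for e :: "nat \<Rightarrow> nat \<Rightarrow> complex" and u v
  proof -
    have "(\<Sum>k<4. cnj (u k) * (\<Sum>j<4. e k j * v j)) = (\<Sum>k<4. \<Sum>j<4. cnj (e j k * u k) * v j)"
      unfolding sum_distrib_left
    proof (intro sum.cong refl)
      fix k j :: nat
      show "cnj (u k) * (e k j * v j) = cnj (e j k * u k) * v j"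
        using e[of k j] by (simp add: mult_ac)
    qed
    also have "\<dots> = (\<Sum>j<4. \<Sum>k<4. cnj (e j k * u k) * v j)" by (rule sum.swap)
    finally show ?thesis by (simp add: sum_distrib_right)
  qed
  \<comment> \<open>Only the empty word feeds the sources: a word contributes by leaving with its
    last letter and returning with its first.\<close>
  have tail: "reentry_form 4 M \<zeta> \<zeta> u v = 0" if "u \<noteq> []" for u v
    using that by (induction v arbitrary: u) (simp_all add: \<zeta>)
  let ?R = "\<lambda>v. reentry_form 4 M \<zeta> \<zeta> [] v"
  have R_Cons: "?R (a # w) = (\<Sum>k<4. cnj (s a k) * lower_part 4 M \<zeta> w k)" for a w
    by (simp add: tail \<zeta>)
  have low1: "lower_part 4 M \<zeta> [a] = s a" for a
    by (rule ext) (simp add: \<zeta>)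
  have low2: "lower_part 4 M \<zeta> (b # a # w) = (\<lambda>k. \<Sum>j<4. M b k j * lower_part 4 M \<zeta> (a # w) j)" for a b w
    by (rule ext) (simp add: \<zeta>)
  have shift: "(\<Sum>k<4. cnj (u k) * (\<Sum>j<4. M a k j * v j)) = (\<Sum>k<4. cnj (\<Sum>j<4. M a k j * u j) * v k)" for a u v
    by (rule self_adjoint) (rule M_herm)
  have Ms: "(\<Sum>j<4. M LX k j * f 1 j) = f 2 k" "(\<Sum>j<4. M LY k j * f 0 j) = f 3 k" for k
    using c(2) d(2) by (simp_all add: M_def)
  have s: "s LX = f 0" "s LY = f 1" by (simp_all add: s_def)
  have R: "?R [] = 0" "?R [a] = 0"
    "?R [LX, LX] = H 0 0" "?R [LX, LY] = 0" "?R [LY, LX] = 0" "?R [LY, LY] = H 1 1"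
    "?R [LX, LX, LY] = H 0 2" "?R [LX, LY, LX] = H 0 3" "?R [LY, LX, LY] = H 1 2" "?R [LY, LY, LX] = H 1 3"
    for a
    unfolding R_Cons low2 low1 s Ms using H01 herm[of 0 1] by (simp_all add: inner_f)
  \<comment> \<open>Here hermitian symmetry has to move one middle letter to the left factor before
    \<open>Ms\<close> applies to it.\<close>
  have R': "?R [LX, LY, LY] = H 3 1" "?R [LY, LX, LX] = H 2 0"
    "?R [LX, LY, LX, LY] = H 3 2" "?R [LX, LY, LY, LX] = H 3 3"
    "?R [LY, LX, LX, LY] = H 2 2" "?R [LY, LX, LY, LX] = H 2 3"
    unfolding R_Cons low2 low1 s Ms unfolding shift Ms by (simp_all only: inner_f)
  have "0 \<le> (\<Sum>v\<in>Poly_Mapping.keys p. Poly_Mapping.lookup p v * ?R (letters v))"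
    by (rule xy_convex_reentry_form[OF p M_herm _ \<zeta>_def]) (use H01 in \<open>simp add: inner_f\<close>)
  also have "\<dots> = (\<Sum>v\<in>pencil_products. P v * ?R v)"
    unfolding P_def by (rule sum_keys_pencil_products[OF sym p])
  finally show ?thesis
    by (simp add: pencil_products_def R R' add_ac del: reentry_form.simps(2))
qed

text \<open>Follows the order of \<open>gram_vec\<close>, whose components are the coefficients of
  these words in a hermitian square. The real parts lose nothing for symmetric \<open>p\<close>,
  since the words concerned are palindromes.\<close>

definition gram_coeffs :: "ncpoly \<Rightarrow> gram_data" where
  "gram_coeffs p = (let P = \<lambda>w. Poly_Mapping.lookup p (Word w) in
     (Re (P [LX, LX]), Re (P [LY, LY]), Re (P [LY, LX, LX, LY]), Re (P [LX, LY, LY, LX]),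
      Re (P [LX, LY, LX]), Re (P [LY, LX, LY]), P [LX, LX, LY], P [LY, LY, LX], P [LY, LX, LY, LX]))"

text \<open>Otherwise some functional is positive on the Gram data of all nonzero vectors and
  negative on \<open>p\<close>; read as a matrix \<open>H\<close>, it contradicts
  \<open>xy_convex_gram_nonneg\<close>.\<close>

lemma xy_convex_gram_coeffs:
  assumes sym: "nc_symmetric p" and p: "xy_convex p"
  shows "\<exists>vs. gram_coeffs p = sum_list (map gram_vec vs)"
proof (rule ccontr)
  assume "\<not> ?thesis"
  then obtain a where a: "inner a (gram_coeffs p) < 0" "\<And>v. v \<noteq> 0 \<Longrightarrow> 0 < inner a (gram_vec v)"
    using gram_data_separation[of "gram_coeffs p"] by blast
  obtain h0 h1 h2 h3 h4 h5 k0 k1 k2 where h: "a = (h0, h1, h2, h3, h4, h5, k0, k1, k2)"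
    by (metis surj_pair)
  \<comment> \<open>The complex components are halved because they occur together with their
    conjugates; for \<open>h4\<close> and \<open>h5\<close> the factor 2 is already part of
    \<open>gram_vec\<close>. The default 0 gives \<open>H 0 1 = 0\<close>.\<close>
  define U :: "nat \<Rightarrow> nat \<Rightarrow> complex" where "U i j =
    (if i = 0 \<and> j = 2 then cnj k0 / 2 else if i = 0 \<and> j = 3 then of_real h4
     else if i = 1 \<and> j = 2 then of_real h5 else if i = 1 \<and> j = 3 then cnj k1 / 2
     else if i = 2 \<and> j = 3 then cnj k2 / 2 else 0)" for i j
  define H :: "nat \<Rightarrow> nat \<Rightarrow> complex" where "H i j =
    (if i = j then of_real (if i = 0 then h0 else if i = 1 then h1 else if i = 2 then h2 else h3)
     else if i < j then U i j else cnj (U j i))" for i j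
  have four: "{..<4} = {0, 1, 2, 3 :: nat}" by auto
  have sum4: "(\<Sum>i<4. F i) = F 0 + F 1 + F 2 + F 3" for F :: "nat \<Rightarrow> complex"
    by (simp add: four)
  have Hv: "H 0 0 = of_real h0" "H 1 1 = of_real h1" "H 2 2 = of_real h2" "H 3 3 = of_real h3"
    "H 0 1 = 0" "H 1 0 = 0" "H 0 2 = cnj k0 / 2" "H 2 0 = k0 / 2" "H 0 3 = of_real h4" "H 3 0 = of_real h4"
    "H 1 2 = of_real h5" "H 2 1 = of_real h5" "H 1 3 = cnj k1 / 2" "H 3 1 = k1 / 2"
    "H 2 3 = cnj k2 / 2" "H 3 2 = k2 / 2"
    by (simp_all add: H_def U_def)
  let ?P = "\<lambda>w. Poly_Mapping.lookup p (Word w)"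
  have real: "Im (?P w) = 0" if "rev w = w" for w
    using lookup_rev_symmetric[OF sym, of w] that by (simp add: complex_eq_iff)
  have rev: "?P [LY, LX, LX] = cnj (?P [LX, LX, LY])" "?P [LX, LY, LY] = cnj (?P [LY, LY, LX])"
    "?P [LX, LY, LX, LY] = cnj (?P [LY, LX, LY, LX])"
    using lookup_rev_symmetric[OF sym, of "[LX, LX, LY]"] lookup_rev_symmetric[OF sym, of "[LY, LY, LX]"]
      lookup_rev_symmetric[OF sym, of "[LY, LX, LY, LX]"] by simp_all
  have "0 \<le> ?P [LX, LX] * H 0 0 + ?P [LY, LY] * H 1 1 + ?P [LY, LX, LX, LY] * H 2 2 + ?P [LX, LY, LY, LX] * H 3 3
    + ?P [LX, LX, LY] * H 0 2 + ?P [LY, LX, LX] * H 2 0 + ?P [LX, LY, LX] * H 0 3 + ?P [LY, LX, LY] * H 1 2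
    + ?P [LY, LY, LX] * H 1 3 + ?P [LX, LY, LY] * H 3 1 + ?P [LY, LX, LY, LX] * H 2 3 + ?P [LX, LY, LX, LY] * H 3 2"
  proof (rule xy_convex_gram_nonneg[OF sym p])
    fix v :: "nat \<Rightarrow> complex" assume v: "\<exists>i<4. v i \<noteq> 0"
    then obtain i where "i \<in> {..<4}" "v i \<noteq> 0" by auto
    then have "(v 0, v 1, v 2, v 3) \<noteq> 0" by (auto simp: four zero_prod_def)
    then have "0 < inner a (gram_vec (v 0, v 1, v 2, v 3))" by (rule a)
    also have "\<dots> = Re (\<Sum>i<4. \<Sum>j<4. cnj (v i) * H i j * v j)"
      unfolding sum4 Hv h gram_vec.simps inner_Pair inner_complex_def inner_real_def cmod_power2
      by (simp add: algebra_simps power2_eq_square)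
    finally show "0 < Re (\<Sum>i<4. \<Sum>j<4. cnj (v i) * H i j * v j)" .
  next
    fix i j :: nat
    show "H j i = cnj (H i j)" by (cases i j rule: linorder_cases) (simp_all add: H_def)
  qed (simp_all add: Hv[simplified])
  then have "0 \<le> inner a (gram_coeffs p)"
    using real[of "[LX, LX]"] real[of "[LY, LY]"] real[of "[LY, LX, LX, LY]"] real[of "[LX, LY, LY, LX]"]
      real[of "[LX, LY, LX]"] real[of "[LY, LX, LY]"]
    unfolding Hv rev less_eq_complex_def gram_coeffs_def h Let_def inner_Pair inner_complex_def inner_real_def
    by (simp add: algebra_simps)
  then show False using a(1) by simp
qed

section \<open>Assembling the pencil and the squares\<close>

lemma nc_gram_pencil_poly:
  "nc_star (pencil_poly 0 v0 v1 v2 v3) * pencil_poly 0 v0 v1 v2 v3 =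
    Poly_Mapping.single (Word [LX, LX]) (cnj v0 * v0) + Poly_Mapping.single (Word [LY, LY]) (cnj v1 * v1)
    + Poly_Mapping.single (Word [LX, LY]) (cnj v0 * v1) + Poly_Mapping.single (Word [LY, LX]) (cnj v1 * v0)
    + Poly_Mapping.single (Word [LX, LX, LY]) (cnj v0 * v2) + Poly_Mapping.single (Word [LY, LX, LX]) (cnj v2 * v0)
    + Poly_Mapping.single (Word [LX, LY, LX]) (cnj v0 * v3 + cnj v3 * v0)
    + Poly_Mapping.single (Word [LY, LX, LY]) (cnj v1 * v2 + cnj v2 * v1)
    + Poly_Mapping.single (Word [LY, LY, LX]) (cnj v1 * v3) + Poly_Mapping.single (Word [LX, LY, LY]) (cnj v3 * v1)
    + Poly_Mapping.single (Word [LY, LX, LX, LY]) (cnj v2 * v2) + Poly_Mapping.single (Word [LX, LY, LY, LX]) (cnj v3 * v3)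
    + Poly_Mapping.single (Word [LY, LX, LY, LX]) (cnj v2 * v3) + Poly_Mapping.single (Word [LX, LY, LX, LY]) (cnj v3 * v2)"
  by (simp add: pencil_poly_def nc_star_add nc_star_single distrib_left distrib_right mult_single plus_word_def
      single_add add_ac)


text \<open>The vectors of the Gram decomposition become the rows of \<open>\<Lambda>\<close>, and
  \<open>l\<close> matches the remaining coefficients at pencil words. The rows have constant term
  0, as products of a constant with a pencil word stay in the pencil.\<close>

lemma xy_convex_imp_pencil_plus_squares:
  assumes sym: "nc_symmetric p" and p: "xy_convex p"
  shows "\<exists>l k \<Lambda>. hermitian_xy_pencil 1 (mat 1 1 (\<lambda>_. l)) \<and> 0 < k \<and> xy_pencil k 1 \<Lambda> \<and>
    p = l + (nc_mat_adjoint \<Lambda> * \<Lambda>) $$ (0, 0)"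
proof -
  let ?P = "\<lambda>w. Poly_Mapping.lookup p (Word w)"
  obtain vs where "gram_coeffs p = sum_list (map gram_vec vs)"
    using xy_convex_gram_coeffs[OF sym p] by blast
  moreover define k where "k = Suc (length vs)"
  \<comment> \<open>The zero row makes \<open>k\<close> positive.\<close>
  moreover define us where "us = (0, 0, 0, 0) # vs"
  ultimately have g: "gram_coeffs p = (\<Sum>i<k. gram_vec (us ! i))" "0 < k"
    by (simp_all add: sum_list_sum_nth atLeast0LessThan sum.lessThan_Suc_shift zero_prod_def del: sum.lessThan_Suc)
  define v0 v1 v2 v3 where "v0 i = fst (us ! i)" and "v1 i = fst (snd (us ! i))"
    and "v2 i = fst (snd (snd (us ! i)))" and "v3 i = snd (snd (snd (us ! i)))" for i
  have us: "us ! i = (v0 i, v1 i, v2 i, v3 i)" for i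
    by (simp add: v0_def v1_def v2_def v3_def)
  have real: "complex_of_real (Re (?P w)) = ?P w" if "rev w = w" for w
    using lookup_rev_symmetric[OF sym, of w] that by (simp add: complex_eq_iff)
  have sq: "complex_of_real ((cmod z)\<^sup>2) = cnj z * z" for z
    using complex_norm_square[of z] by (simp add: mult.commute)
  have re: "complex_of_real (2 * Re (cnj z * w)) = cnj z * w + cnj w * z" for z w
    by (simp add: complex_eq_iff)
  have coeffs:
    "Re (?P [LX, LX]) = (\<Sum>i<k. (cmod (v0 i))\<^sup>2)" "Re (?P [LY, LY]) = (\<Sum>i<k. (cmod (v1 i))\<^sup>2)"
    "Re (?P [LY, LX, LX, LY]) = (\<Sum>i<k. (cmod (v2 i))\<^sup>2)" "Re (?P [LX, LY, LY, LX]) = (\<Sum>i<k. (cmod (v3 i))\<^sup>2)"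
    "Re (?P [LX, LY, LX]) = (\<Sum>i<k. 2 * Re (cnj (v0 i) * v3 i))" "Re (?P [LY, LX, LY]) = (\<Sum>i<k. 2 * Re (cnj (v1 i) * v2 i))"
    "?P [LX, LX, LY] = (\<Sum>i<k. cnj (v0 i) * v2 i)" "?P [LY, LY, LX] = (\<Sum>i<k. cnj (v1 i) * v3 i)"
    "?P [LY, LX, LY, LX] = (\<Sum>i<k. cnj (v2 i) * v3 i)"
    using g(1) unfolding us gram_vec.simps gram_coeffs_def Let_def prod_eq_iff fst_sum snd_sum fst_conv snd_conv
    by blast+
  have coeffs':
    "?P [LX, LX] = (\<Sum>i<k. cnj (v0 i) * v0 i)" "?P [LY, LY] = (\<Sum>i<k. cnj (v1 i) * v1 i)"
    "?P [LY, LX, LX, LY] = (\<Sum>i<k. cnj (v2 i) * v2 i)" "?P [LX, LY, LY, LX] = (\<Sum>i<k. cnj (v3 i) * v3 i)"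
    "?P [LX, LY, LX] = (\<Sum>i<k. cnj (v0 i) * v3 i + cnj (v3 i) * v0 i)"
    "?P [LY, LX, LY] = (\<Sum>i<k. cnj (v1 i) * v2 i + cnj (v2 i) * v1 i)"
    using coeffs(1-6)[THEN arg_cong[where f = complex_of_real]] unfolding of_real_sum sq re
    by (simp_all only: real rev.simps append.simps)
  have coeffs'':
    "?P [LY, LX, LX] = (\<Sum>i<k. cnj (v2 i) * v0 i)" "?P [LX, LY, LY] = (\<Sum>i<k. cnj (v3 i) * v1 i)"
    "?P [LX, LY, LX, LY] = (\<Sum>i<k. cnj (v3 i) * v2 i)"
    using lookup_rev_symmetric[OF sym, of "[LX, LX, LY]"] lookup_rev_symmetric[OF sym, of "[LY, LY, LX]"]
      lookup_rev_symmetric[OF sym, of "[LY, LX, LY, LX]"]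
    by (simp_all add: coeffs(7-9) mult.commute)
  define S where "S = (\<Sum>i<k. nc_star (pencil_poly 0 (v0 i) (v1 i) (v2 i) (v3 i)) * pencil_poly 0 (v0 i) (v1 i) (v2 i) (v3 i))"
  \<comment> \<open>The part of the coefficient of \<open>x y\<close> that the squares do not
    produce.\<close>
  define c where "c = ?P [LX, LY] - (\<Sum>i<k. cnj (v0 i) * v1 i)"
  define l where "l = pencil_poly (?P []) (?P [LX]) (?P [LY]) c (cnj c)"
  have pS: "p = l + S"
  proof (rule poly_mapping_eqI)
    fix w
    obtain v where w: "w = Word v" by (cases w)
    have c: "?P [LX, LY] = c + (\<Sum>i<k. cnj (v0 i) * v1 i)"
      "?P [LY, LX] = cnj c + (\<Sum>i<k. cnj (v1 i) * v0 i)"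
      using lookup_rev_symmetric[OF sym, of "[LX, LY]"] by (simp_all add: c_def mult.commute)
    show "Poly_Mapping.lookup p w = Poly_Mapping.lookup (l + S) w"
    proof (cases "v \<in> pencil_products")
      case True
      then show ?thesis
        unfolding S_def nc_gram_pencil_poly lookup_add lookup_sum
        unfolding l_def pencil_poly_def pencil_products_def lookup_add
        by (elim insertE emptyE; simp only: w)
          (simp_all add: c lookup_single coeffs(7-9) coeffs' coeffs'' sum.distrib)
    next
      case False
      then have "Poly_Mapping.lookup p w = 0"
        using xy_convex_keys[OF sym p] by (auto simp: w in_keys_iff)
      moreover have "Poly_Mapping.lookup (l + S) w = 0"
        using False unfolding S_def nc_gram_pencil_poly lookup_add lookup_sum
        unfolding l_def pencil_poly_def pencil_products_def lookup_add lookup_single w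
        by (simp add: when_def eq_commute[of _ v])
      ultimately show ?thesis by simp
    qed
  qed
  define col where "col f = mat k 1 (\<lambda>(i, j). f i)" for f :: "nat \<Rightarrow> complex"
  define \<Lambda> where "\<Lambda> = xy_pencil_of (col (\<lambda>_. 0)) (col v0) (col v1) (col v2) (col v3)"
  have col: "col f \<in> carrier_mat k 1" for f by (simp add: col_def)
  have \<Lambda>: "xy_pencil k 1 \<Lambda>"
    unfolding xy_pencil_def \<Lambda>_def using col by blast
  have "\<Lambda> $$ (i, 0) = pencil_poly 0 (v0 i) (v1 i) (v2 i) (v3 i)" if "i < k" for i
    using that index_xy_pencil_of[OF col col col col col that, of 0] by (simp add: \<Lambda>_def col_def)
  moreover have "\<Lambda> \<in> carrier_mat k 1"
    by (auto simp: \<Lambda>_def xy_pencil_of_def col_def)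
  ultimately have S: "(nc_mat_adjoint \<Lambda> * \<Lambda>) $$ (0, 0) = S"
    by (simp add: index_nc_gram S_def)
  define one where "one z = mat 1 1 (\<lambda>_. z)" for z :: complex
  have one: "one z \<in> carrier_mat 1 1" "one z $$ (0, 0) = z" for z by (simp_all add: one_def)
  \<comment> \<open>Coefficients at palindromes are real by symmetry.\<close>
  have herm: "hermitian_mat 1 (one (?P w))" if "rev w = w" for w
    using lookup_rev_symmetric[OF sym, of w] that
    by (auto simp: hermitian_mat_def one_def intro!: eq_matI)
  have "mat 1 1 (\<lambda>_. l) = xy_pencil_of (one (?P [])) (one (?P [LX])) (one (?P [LY])) (one c) (mat_adjoint (one c))"
  proof (rule eq_matI)
    fix i j assume "i < dim_row (xy_pencil_of (one (?P [])) (one (?P [LX])) (one (?P [LY])) (one c) (mat_adjoint (one c)))"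
      "j < dim_col (xy_pencil_of (one (?P [])) (one (?P [LX])) (one (?P [LY])) (one c) (mat_adjoint (one c)))"
    then have "i = 0" "j = 0" by (auto simp: xy_pencil_of_def one_def)
    then show "mat 1 1 (\<lambda>_. l) $$ (i, j)
        = xy_pencil_of (one (?P [])) (one (?P [LX])) (one (?P [LY])) (one c) (mat_adjoint (one c)) $$ (i, j)"
      using index_xy_pencil_of[OF one(1) one(1) one(1) one(1) mat_adjoint_closed[OF one(1)], of 0 0]
      by (simp add: l_def one_def)
  qed (auto simp: xy_pencil_of_def one_def)
  moreover have "hermitian_mat 1 (one (?P []))" "hermitian_mat 1 (one (?P [LX]))" "hermitian_mat 1 (one (?P [LY]))"
    by (rule herm; simp)+
  ultimately have "hermitian_xy_pencil 1 (mat 1 1 (\<lambda>_. l))"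
    unfolding hermitian_xy_pencil_def using one(1) by blast
  then show ?thesis using pS S \<Lambda> g(2) by metis
qed

theorem theorem1p4:
  fixes p :: ncpoly
  shows "(nc_symmetric p \<and> xy_convex p \<longrightarrow>
           (\<exists>l k \<Lambda>. hermitian_xy_pencil 1 (mat 1 1 (\<lambda>_. l)) \<and> 0 < k \<and> xy_pencil k 1 \<Lambda> \<and>
              p = l + (nc_mat_adjoint \<Lambda> * \<Lambda>) $$ (0, 0)))
       \<and> ((\<exists>l k \<Lambda>. hermitian_xy_pencil 1 (mat 1 1 (\<lambda>_. l)) \<and> 0 < k \<and> xy_pencil k 1 \<Lambda> \<and>
              p = l + (nc_mat_adjoint \<Lambda> * \<Lambda>) $$ (0, 0))
           \<longrightarrow> xy_convex p)"
  using xy_convex_imp_pencil_plus_squares[of p] xy_convex_pencil_plus_squares by blast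

end
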